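(* Under bivalued utilities, there exists a polynomial-time algorithm which, given agents $N$, objects $O$, bivalued additive utilities $(u_1,\dots,u_n)$ and an assignment $p$, decides whether $p$ is Pareto optimal and, if it is not, outputs an assignment that Pareto dominates $p$.
   Context: $N=\{1,\dots,n\}$ is a set of agents and $O=\{o_1,\dots,o_m\}$ a set of objects. An assignment $p=(p(1),\dots,p(n))$ is a partition of $O$ into $n$ (possibly empty) subsets, $p(i)$ being the bundle of agent $i$. Each agent $i$ has a utility $u_i(o)\ge 0$ (a rational number) for each object, extended additively: $u_i(S)=\sum_{o\in S}u_i(o)$ for $S\subseteq O$. The collection $(u_1,\dots,u_n)$ is bivalued if there exist two numbers $\alpha>\beta\ge 0$ such that $u_i(o)\in\{\alpha,\beta\}$ for every agent $i$ and object $o$. Assignment $q$ Pareto dominates $p$ (is a Pareto improvement of $p$) if $u_i(q(i))\ge u_i(p(i))$ for all $i\in N$ and $u_i(q(i))>u_i(p(i))$ for at least one $i\in N$. An assignment is Pareto optimal if no assignment Pareto dominates it. *)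

theory Defs
  imports
    Complex_Main
    "HOL-Library.Disjoint_Sets"
    "HOL-Library.Log_Nat"
    "HOL-Computational_Algebra.Polynomial"
begin

definition assignment :: "'i set \<Rightarrow> 'o set \<Rightarrow> ('i \<Rightarrow> 'o set) \<Rightarrow> bool" where
  "assignment N Ob p \<longleftrightarrow> disjoint_family_on p N \<and> (\<Union>i\<in>N. p i) = Ob"

definition utility :: "('i \<Rightarrow> 'o \<Rightarrow> rat) \<Rightarrow> 'i \<Rightarrow> 'o set \<Rightarrow> rat" where
  "utility u i S = (\<Sum>x\<in>S. u i x)"

definition bivalued :: "'i set \<Rightarrow> 'o set \<Rightarrow> ('i \<Rightarrow> 'o \<Rightarrow> rat) \<Rightarrow> bool" where
  "bivalued N Ob u \<longleftrightarrow>
     (\<exists>\<alpha> \<beta>. \<alpha> > \<beta> \<and> \<beta> \<ge> 0 \<and> (\<forall>i\<in>N. \<forall>x\<in>Ob. u i x \<in> {\<alpha>, \<beta>}))"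

definition pareto_dominates ::
  "'i set \<Rightarrow> ('i \<Rightarrow> 'o \<Rightarrow> rat) \<Rightarrow> ('i \<Rightarrow> 'o set) \<Rightarrow> ('i \<Rightarrow> 'o set) \<Rightarrow> bool" where
  "pareto_dominates N u q p \<longleftrightarrow>
     (\<forall>i\<in>N. utility u i (q i) \<ge> utility u i (p i)) \<and>
     (\<exists>i\<in>N. utility u i (q i) > utility u i (p i))"

definition pareto_optimal ::
  "'i set \<Rightarrow> 'o set \<Rightarrow> ('i \<Rightarrow> 'o \<Rightarrow> rat) \<Rightarrow> ('i \<Rightarrow> 'o set) \<Rightarrow> bool" where
  "pareto_optimal N Ob u p \<longleftrightarrow> \<not> (\<exists>q. assignment N Ob q \<and> pareto_dominates N u q p)"

text \<open>
  The machine model is the random access machine under the logarithmic cost criterion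
  (Cook and Reckhow; Aho, Hopcroft and Ullman), programmed with structured control flow.
  It is polynomially related to Turing machines. The memory consists of arrays of natural
  numbers; array \<open>a\<close> has the cells \<open>s a 0, s a 1, \<dots>\<close>, and a program can
  only address the finitely many arrays it mentions by name. Every operation is charged the
  number of binary digits of the numbers it handles, including the addresses, so that neither
  large numbers nor far-away cells come for free.
\<close>

type_synonym state = "nat \<Rightarrow> nat \<Rightarrow> nat"

datatype exp =
    Const nat
  | Cell nat exp
  | Plus exp exp
  | Minus exp exp
  | Times exp exp

text \<open>In \<open>IF\<close> and \<open>WHILE\<close> any nonzero value counts as true.\<close>

datatype com =
    SKIP
  | Assign nat exp exp
  | Seq com com
  | IF exp com com
  | WHILE exp com

fun val :: "exp \<Rightarrow> state \<Rightarrow> nat" where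
  "val (Const k) s = k"
| "val (Cell a e) s = s a (val e s)"
| "val (Plus e f) s = val e s + val f s"
| "val (Minus e f) s = val e s - val f s"
| "val (Times e f) s = val e s * val f s"

text \<open>
  \<open>floorlog 2 x\<close> is the number of binary digits of \<open>x\<close> (none for \<open>x = 0\<close>);
  the additional unit makes handling a zero cost something and, for lists, pays for a separator.
\<close>

definition bits :: "nat \<Rightarrow> nat" where
  "bits x = Suc (floorlog 2 x)"

definition bit_size :: "nat list \<Rightarrow> nat" where
  "bit_size xs = (\<Sum>x\<leftarrow>xs. bits x)"

fun cost :: "exp \<Rightarrow> state \<Rightarrow> nat" where
  "cost (Const k) s = bits k"
| "cost (Cell a e) s = cost e s + bits (val e s) + bits (s a (val e s))"
| "cost (Plus e f) s = cost e s + cost f s + bits (val e s) + bits (val f s)"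
| "cost (Minus e f) s = cost e s + cost f s + bits (val e s) + bits (val f s)"
| "cost (Times e f) s = cost e s + cost f s + bits (val e s) + bits (val f s)"

text \<open>
  \<open>exec c s t s'\<close>: started in \<open>s\<close>, program \<open>c\<close> halts in \<open>s'\<close>
  after time \<open>t\<close>.
\<close>

inductive exec :: "com \<Rightarrow> state \<Rightarrow> nat \<Rightarrow> state \<Rightarrow> bool" where
  Skip: "exec SKIP s 1 s"
| Assign: "exec (Assign a e f) s
     (cost e s + cost f s + bits (val e s) + bits (val f s))
     (s(a := (s a)(val e s := val f s)))"
| Seq: "exec c s t s' \<Longrightarrow> exec d s' t' s'' \<Longrightarrow> exec (Seq c d) s (t + t') s''"
| IfTrue: "val e s \<noteq> 0 \<Longrightarrow> exec c s t s' \<Longrightarrow>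
     exec (IF e c d) s (cost e s + bits (val e s) + t) s'"
| IfFalse: "val e s = 0 \<Longrightarrow> exec d s t s' \<Longrightarrow>
     exec (IF e c d) s (cost e s + bits (val e s) + t) s'"
| WhileFalse: "val e s = 0 \<Longrightarrow> exec (WHILE e c) s (cost e s + bits (val e s)) s"
| WhileTrue: "val e s \<noteq> 0 \<Longrightarrow> exec c s t s' \<Longrightarrow> exec (WHILE e c) s' t' s'' \<Longrightarrow>
     exec (WHILE e c) s (cost e s + bits (val e s) + t + t') s''"

lemma exec_deterministic:
  "exec c s t s' \<Longrightarrow> exec c s r s'' \<Longrightarrow> r = t \<and> s'' = s'"
proof (induction arbitrary: r s'' rule: exec.induct)
  case (Skip s)
  then show ?case by cases auto
next
  case (Assign a e f s)
  then show ?case by cases auto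
next
  case (Seq c s t s' d t' s2)
  from Seq.prems obtain q q' s3 where
    "exec c s q s3" "exec d s3 q' s''" "r = q + q'"
    by cases auto
  with Seq.IH show ?case by metis
next
  case (IfTrue e s c t s' d)
  from IfTrue.prems IfTrue.hyps(1) obtain q where
    "exec c s q s''" "r = cost e s + bits (val e s) + q"
    by cases auto
  with IfTrue.IH show ?case by metis
next
  case (IfFalse e s d t s' c)
  from IfFalse.prems IfFalse.hyps(1) obtain q where
    "exec d s q s''" "r = cost e s + bits (val e s) + q"
    by cases auto
  with IfFalse.IH show ?case by metis
next
  case (WhileFalse e s c)
  from WhileFalse.prems WhileFalse.hyps show ?case by cases auto
next
  case (WhileTrue e s c t s' t' s2)
  from WhileTrue.prems WhileTrue.hyps(1) obtain q q' s3 where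
    "exec c s q s3" "exec (WHILE e c) s3 q' s''"
    "r = cost e s + bits (val e s) + q + q'"
    by cases auto
  with WhileTrue.IH show ?case by metis
qed

text \<open>
  The input is given in array \<open>0\<close>, all other cells being \<open>0\<close>. The output is left
  in array \<open>1\<close>, with its length in cell \<open>0\<close> and its entries in the cells from
  \<open>1\<close> on; it is charged to the running time as well.
\<close>

definition init :: "nat list \<Rightarrow> state" where
  "init xs = (\<lambda>a i. if a = 0 \<and> i < length xs then xs ! i else 0)"

definition result_of :: "state \<Rightarrow> nat list" where
  "result_of s = map (s 1) [1..<Suc (s 1 0)]"

definition runs :: "com \<Rightarrow> nat list \<Rightarrow> nat list \<Rightarrow> nat \<Rightarrow> bool" where
  "runs c xs ys t \<longleftrightarrow> (\<exists>s t'. exec c (init xs) t' s \<and> ys = result_of s \<and> t = t' + bit_size ys)"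

text \<open>
  Agents are \<open>1, \<dots>, n\<close>, and object \<open>o\<^sub>j\<close> is represented by its index
  \<open>j \<in> {1..m}\<close>. A utility is written as numerator and denominator in lowest terms
  (used for nonnegative numbers only), an assignment as the list of the owners of the objects.
\<close>

definition encode_rat :: "rat \<Rightarrow> nat list" where
  "encode_rat r = [nat (fst (quotient_of r)), nat (snd (quotient_of r))]"

definition encode_utilities :: "nat \<Rightarrow> nat \<Rightarrow> (nat \<Rightarrow> nat \<Rightarrow> rat) \<Rightarrow> nat list" where
  "encode_utilities n m u =
     concat (map (\<lambda>i. concat (map (\<lambda>j. encode_rat (u i j)) [1..<Suc m])) [1..<Suc n])"

definition encode_assignment :: "nat \<Rightarrow> nat \<Rightarrow> (nat \<Rightarrow> nat set) \<Rightarrow> nat list" where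
  "encode_assignment n m p = map (\<lambda>j. THE i. i \<in> {1..n} \<and> j \<in> p i) [1..<Suc m]"

definition encode_instance ::
  "nat \<Rightarrow> nat \<Rightarrow> (nat \<Rightarrow> nat \<Rightarrow> rat) \<Rightarrow> (nat \<Rightarrow> nat set) \<Rightarrow> nat list" where
  "encode_instance n m u p = [n, m] @ encode_utilities n m u @ encode_assignment n m p"

text \<open>\<open>None\<close> is the answer ``Pareto optimal''; \<open>Some q\<close> exhibits a Pareto improvement.\<close>

definition encode_answer :: "nat \<Rightarrow> nat \<Rightarrow> (nat \<Rightarrow> nat set) option \<Rightarrow> nat list" where
  "encode_answer n m ans =
     (case ans of None \<Rightarrow> [1] | Some q \<Rightarrow> 0 # encode_assignment n m q)"

end

theory Submission
  imports Defs
begin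

text \<open>
  Let object \<open>x\<close> be owned by \<open>i\<close> and be liked more by \<open>j\<close>. Giving \<open>x\<close> to \<open>j\<close> leaves \<open>j\<close>
  with a surplus worth \<open>\<alpha>\<close>, at a loss of \<open>\<beta>\<close> for \<open>i\<close>. The surplus is passed on whenever its
  holder gives an object away to an agent of utility \<open>\<alpha>\<close> for that object. The search stops with
  a Pareto improvement if a holder has an object worth \<open>\<beta>\<close> to him, or one worth \<open>\<alpha>\<close> to \<open>i\<close>,
  which he then returns to \<open>i\<close>, or if \<open>\<beta> = 0\<close>. Otherwise the agents reached own only objects
  worth \<open>\<alpha>\<close> to them, and no other agent likes these. If this happens for every \<open>x\<close>, then the given
  assignment maximises the welfare in which the agents reached count with weight \<open>\<beta> / \<alpha>\<close> and
  the others with weight \<open>1\<close>, object by object, so that it is Pareto optimal.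

  The search is written with counting loops only. Such programs assign no number above
  those of the input but for \<open>m + 1\<close>, so that the running time is read off the nesting of loops.
\<close>

section \<open>Counting programs and their running time\<close>

lemma floorlog_2_less: "x < 2 ^ floorlog 2 x"
  by (cases "x = 0") (simp_all add: floorlog_bounds)

lemma floorlog_2_le: "x < 2 ^ k \<Longrightarrow> floorlog 2 x \<le> k"
  by (rule floorlog_leI) auto

lemma bits_mono: "x \<le> y \<Longrightarrow> bits x \<le> bits y"
  unfolding bits_def by (simp add: floorlog_mono)

lemma bits_pos: "1 \<le> bits x"
  unfolding bits_def by simp

lemma bits_mult: "bits (x * y) \<le> bits x + bits y"
proof -
  have "x * y < 2 ^ floorlog 2 x * 2 ^ floorlog 2 y"
    by (intro mult_strict_mono floorlog_2_less) auto
  then have "floorlog 2 (x * y) \<le> floorlog 2 x + floorlog 2 y"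
    by (intro floorlog_2_le) (simp add: power_add)
  then show ?thesis unfolding bits_def by simp
qed

lemma bits_power: "bits (x ^ Suc k) \<le> Suc k * bits x"
proof (induction k)
  case (Suc k)
  then show ?case using bits_mult[of x "x ^ Suc k"] by simp
qed simp

section \<open>Values and costs of expressions under a common bound on all cells\<close>

text \<open>If every cell is at most some \<open>M \<ge> 2\<close>, the value is at most
  \<open>M ^ weight e\<close>, which makes its \<open>bits\<close> at most
  \<open>weight e * bits M\<close>. A cell counts 1 whatever its address; \<open>Suc k\<close> for a
  constant avoids logarithms and keeps weights positive.\<close>

fun weight :: "exp \<Rightarrow> nat" where
  "weight (Const k) = Suc k"
| "weight (Cell a e) = 1"
| "weight (Plus e f) = weight e + weight f"
| "weight (Minus e f) = weight e + weight f"
| "weight (Times e f) = weight e + weight f"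

text \<open>The coefficient for \<open>cost\<close> in units of \<open>bits M\<close>: each term of
  \<open>cost\<close> is replaced by its bound through \<open>weight\<close>.\<close>

fun charge :: "exp \<Rightarrow> nat" where
  "charge (Const k) = Suc k"
| "charge (Cell a e) = charge e + weight e + 1"
| "charge (Plus e f) = charge e + charge f + weight e + weight f"
| "charge (Minus e f) = charge e + charge f + weight e + weight f"
| "charge (Times e f) = charge e + charge f + weight e + weight f"

lemma weight_pos: "1 \<le> weight e"
  by (induction e) auto

lemma val_le_power_weight:
  assumes "2 \<le> M" "\<forall>a i. s a i \<le> M"
  shows "val e s \<le> M ^ weight e"
proof (induction e)
  case (Const k)
  have "k \<le> 2 ^ k" by (simp add: less_imp_le)
  also have "\<dots> \<le> M ^ k" using assms by (intro power_mono) auto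
  also have "\<dots> \<le> M ^ Suc k" using assms by simp
  finally show ?case by simp
next
  case (Cell a e)
  then show ?case using assms by simp
next
  case (Plus e f)
  \<comment> \<open>Both powers are at least 2, so their sum is at most their product, and exponents
    add for \<open>Plus\<close> just as for \<open>Times\<close>.\<close>
  have two: "2 \<le> M ^ weight g" for g
    using assms(1) weight_pos[of g] self_le_power[of M "weight g"] by linarith
  have sum_le: "x + y \<le> x * y" if "2 \<le> x" "2 \<le> y" for x y :: nat
  proof -
    have "x + y \<le> 2 * max x y" by simp
    also have "\<dots> \<le> min x y * max x y" using that by (intro mult_le_mono1) simp
    also have "\<dots> = x * y" by (simp add: min_def max_def)
    finally show ?thesis .
  qed
  have "val e s + val f s \<le> M ^ weight e + M ^ weight f"
    using Plus by simp
  also have "\<dots> \<le> M ^ weight e * M ^ weight f" using sum_le two by blast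
  finally show ?case by (simp add: power_add)
next
  case (Minus e f)
  have "val e s - val f s \<le> M ^ weight e * 1" using Minus by simp
  also have "\<dots> \<le> M ^ weight e * M ^ weight f" using assms by (intro mult_le_mono) auto
  finally show ?case by (simp add: power_add)
next
  case (Times e f)
  then show ?case by (simp add: power_add mult_le_mono)
qed

lemma bits_val_le:
  assumes "2 \<le> M" "\<forall>a i. s a i \<le> M"
  shows "bits (val e s) \<le> weight e * bits M"
proof -
  obtain k where k: "weight e = Suc k" using weight_pos[of e] by (cases "weight e") auto
  show ?thesis
    using order_trans[OF bits_mono[OF val_le_power_weight[OF assms, where e = e]] bits_power[of M k, folded k]] .
qed

lemma cost_le:
  assumes "2 \<le> M" "\<forall>a i. s a i \<le> M"
  shows "cost e s \<le> charge e * bits M"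
proof (induction e)
  case (Const k)
  show ?case using bits_val_le[where e = "Const k", OF assms] by simp
next
  case (Cell a e)
  then show ?case
    using bits_val_le[where e = e, OF assms] bits_mono[OF assms(2)[rule_format, of a "val e s"]]
    by (simp add: add_mult_distrib)
next
  case (Plus e f)
  then show ?case using bits_val_le[where e = e, OF assms] bits_val_le[where e = f, OF assms]
    by (simp add: add_mult_distrib)
next
  case (Minus e f)
  then show ?case using bits_val_le[where e = e, OF assms] bits_val_le[where e = f, OF assms]
    by (simp add: add_mult_distrib)
next
  case (Times e f)
  then show ?case using bits_val_le[where e = e, OF assms] bits_val_le[where e = f, OF assms]
    by (simp add: add_mult_distrib)
qed

section \<open>Programs with counting loops, their effect and their time bound\<close>

text \<open>
  \<open>Loop a k p\<close> counts cell \<open>0\<close> of array \<open>a\<close> down from the \<open>k\<close>-th input number to \<open>1\<close>,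
  so that the counter never exceeds the numbers of the input.
\<close>

datatype prog =
    Put nat exp exp
  | Then prog prog
  | When exp prog
  | Loop nat nat prog

fun compile :: "prog \<Rightarrow> com" where
  "compile (Put a e f) = Assign a e f"
| "compile (Then p q) = Seq (compile p) (compile q)"
| "compile (When e p) = IF e (compile p) SKIP"
| "compile (Loop a k p) =
     Seq (Assign a (Const 0) (Cell 0 (Const k)))
       (WHILE (Cell a (Const 0))
         (Seq (compile p) (Assign a (Const 0) (Minus (Cell a (Const 0)) (Const 1)))))"

definition upd :: "nat \<Rightarrow> nat \<Rightarrow> nat \<Rightarrow> state \<Rightarrow> state" where
  "upd a i v s = s(a := (s a)(i := v))"

lemma upd_apply: "upd a i v s b = (if b = a then (s a)(i := v) else s b)"
  unfolding upd_def by simp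

text \<open>The counter is set at the start of each iteration instead of being decremented at its
  end, so its value is independent of the body. The compiled loop agrees with this as long as the
  body leaves the array of the counter alone, as \<open>legal\<close> demands.\<close>

fun loop :: "nat \<Rightarrow> (state \<Rightarrow> state) \<Rightarrow> nat \<Rightarrow> state \<Rightarrow> state" where
  "loop a F 0 s = upd a 0 0 s"
| "loop a F (Suc i) s = loop a F i (F (upd a 0 (Suc i) s))"

fun run :: "prog \<Rightarrow> state \<Rightarrow> state" where
  "run (Put a e f) s = upd a (val e s) (val f s) s"
| "run (Then p q) s = run q (run p s)"
| "run (When e p) s = (if val e s = 0 then s else run p s)"
| "run (Loop a k p) s = loop a (run p) (s 0 k) s"

fun targets :: "prog \<Rightarrow> nat set" where
  "targets (Put a e f) = {a}"
| "targets (Then p q) = targets p \<union> targets q"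
| "targets (When e p) = targets p"
| "targets (Loop a k p) = insert a (targets p)"

text \<open>Right-hand sides that create no number beyond a bound \<open>M\<close> on the cells: 0
  or 1, a copied cell, or the successor of an input number, these being strictly below
  \<open>M\<close>. Values therefore cannot grow from one iteration to the next.\<close>

fun small :: "exp \<Rightarrow> bool" where
  "small (Const k) = (k \<le> 1)"
| "small (Cell a e) = True"
| "small (Plus e f) = ((\<exists>g. e = Cell 0 g) \<and> f = Const 1)"
| "small _ = False"

text \<open>
  The flag records whether a loop over the second input number encloses the program. A loop
  over the first number \<open>n\<close> is legal only then: if there are no objects, then \<open>n\<close> can be
  exponential in the size of the input.
\<close>

fun legal :: "bool \<Rightarrow> prog \<Rightarrow> bool" where
  "legal b (Put a e f) = (a \<noteq> 0 \<and> small f)"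
| "legal b (Then p q) = (legal b p \<and> legal b q)"
| "legal b (When e p) = legal b p"
| "legal b (Loop a k p) = (a \<noteq> 0 \<and> a \<notin> targets p \<and>
     (if k = 0 then b \<and> legal b p else k = 1 \<and> legal True p))"

text \<open>The unit is \<open>bits M\<close>, and the argument bounds the number of iterations of
  every loop. The 20 units per iteration pay for the test and the decrement;
  \<open>2 * k + 20\<close> pays for setting the counter and for the last test.\<close>

fun time :: "prog \<Rightarrow> nat poly" where
  "time (Put a e f) = [:charge e + charge f + weight e + weight f:]"
| "time (Then p q) = time p + time q"
| "time (When e p) = time p + [:charge e + weight e + 1:]"
| "time (Loop a k p) = [:0, 1:] * (time p + [:20:]) + [:2 * k + 20:]"

lemma loop_frame:
  assumes "b \<noteq> a" "\<And>s. F s b = s b"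
  shows "loop a F i s b = s b"
  by (induction i arbitrary: s) (simp_all add: assms upd_apply)

lemma run_frame: "b \<notin> targets p \<Longrightarrow> run p s b = s b"
  by (induction p arbitrary: s) (auto simp: upd_apply loop_frame)

lemma val_small_le:
  assumes "small f" "2 \<le> M" "\<forall>a i. s a i \<le> M" "\<forall>i. s 0 i < M"
  shows "val f s \<le> M"
  using assms by (cases f rule: small.cases) (auto simp: Suc_le_eq)

lemma targets_not_0: "legal b p \<Longrightarrow> 0 \<notin> targets p"
  by (induction p arbitrary: b) (auto split: if_splits)

text \<open>Time and the bound on the cells go into one induction: as no cell ever exceeds
  \<open>M\<close>, the same estimate holds for every pass through a loop body. The flag
  \<open>b\<close> stands for the presence of objects, under which the first input number is at most
  \<open>N\<close>.\<close>

lemma exec_compile: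
  assumes "legal b p" "2 \<le> M" "\<forall>a i. s a i \<le> M" "\<forall>i. s 0 i < M"
    and "s 0 1 \<le> N" "s 0 1 \<noteq> 0 \<Longrightarrow> s 0 0 \<le> N" "b \<Longrightarrow> s 0 1 \<noteq> 0"
  shows "(\<exists>t. exec (compile p) s t (run p s) \<and> t \<le> poly (time p) N * bits M)
    \<and> (\<forall>a i. run p s a i \<le> M)"
  using assms
proof (induction p arbitrary: b s)
  case (Put a e f)
  have "exec (Assign a e f) s (cost e s + cost f s + bits (val e s) + bits (val f s))
    (run (Put a e f) s)"
    unfolding run.simps upd_def by (rule exec.Assign)
  moreover have "cost e s + cost f s + bits (val e s) + bits (val f s)
    \<le> poly (time (Put a e f)) N * bits M"
    using cost_le[where e = e, OF Put.prems(2,3)] cost_le[where e = f, OF Put.prems(2,3)]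
      bits_val_le[where e = e, OF Put.prems(2,3)] bits_val_le[where e = f, OF Put.prems(2,3)]
    by (simp add: add_mult_distrib)
  moreover have "val f s \<le> M" using Put.prems(1-4) by (intro val_small_le) auto
  then have "\<forall>b i. run (Put a e f) s b i \<le> M" using Put.prems(3) by (simp add: upd_apply)
  ultimately show ?case unfolding compile.simps by blast
next
  case (Then p q)
  let ?s = "run p s"
  have eq: "?s 0 = s 0"
    using Then.prems(1) by (intro run_frame) (auto dest: targets_not_0)
  from Then.IH(1)[of b s] Then.prems obtain t where
    t: "exec (compile p) s t ?s" "t \<le> poly (time p) N * bits M" and b: "\<forall>a i. ?s a i \<le> M"
    by auto
  from Then.IH(2)[of b ?s] Then.prems eq b obtain t' where
    t': "exec (compile q) ?s t' (run q ?s)" "t' \<le> poly (time q) N * bits M"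
    and "\<forall>a i. run q ?s a i \<le> M"
    by auto
  moreover have "exec (compile (Then p q)) s (t + t') (run q ?s)"
    using t t' by (auto intro: exec.Seq)
  ultimately show ?case using t(2) by (auto simp: add_mult_distrib intro!: exI[of _ "t + t'"])
next
  case (When e p)
  have c: "cost e s + bits (val e s) \<le> (charge e + weight e) * bits M"
    using cost_le[where e = e, OF When.prems(2,3)] bits_val_le[where e = e, OF When.prems(2,3)]
    by (simp add: add_mult_distrib)
  show ?case
  proof (cases "val e s = 0")
    case True
    have "exec (compile (When e p)) s (cost e s + bits (val e s) + 1) s"
      using exec.IfFalse[OF True exec.Skip] by simp
    moreover have "cost e s + bits (val e s) + 1 \<le> poly (time (When e p)) N * bits M"
      using c bits_pos[of M] by (simp add: add_mult_distrib)
    ultimately show ?thesis using True When.prems(3) by auto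
  next
    case False
    from When.IH[of b s] When.prems obtain t where
      t: "exec (compile p) s t (run p s)" "t \<le> poly (time p) N * bits M"
      and "\<forall>a i. run p s a i \<le> M"
      by auto
    moreover have "exec (compile (When e p)) s (cost e s + bits (val e s) + t) (run p s)"
      using False t by (auto intro: exec.IfTrue)
    moreover have "cost e s + bits (val e s) + t \<le> poly (time (When e p)) N * bits M"
      using c t(2) by (simp add: add_mult_distrib)
    ultimately show ?thesis using False by auto
  qed
next
  case (Loop a k p)
  have a: "a \<noteq> 0" "a \<notin> targets p" "0 \<notin> targets p"
    using Loop.prems(1) by (auto dest: targets_not_0 split: if_splits)
  let ?e = "Cell a (Const 0)" and ?d = "Assign a (Const 0) (Minus (Cell a (Const 0)) (Const 1))"
  let ?w = "WHILE ?e (Seq (compile p) ?d)"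
  \<comment> \<open>The body matters only if the loop is entered; for \<open>k = 1\<close> this
    means \<open>s 0 1 \<noteq> 0\<close>, which is what the flag \<open>True\<close> asks
    for.\<close>
  have body: "(\<exists>t. exec (compile p) r t (run p r) \<and> t \<le> poly (time p) N * bits M)
    \<and> (\<forall>a i. run p r a i \<le> M)"
    if "\<forall>a i. r a i \<le> M" "r 0 = s 0" "s 0 k \<noteq> 0" for r
    using Loop.IH[of "if k = 0 then b else True" r] Loop.prems that
    by (auto split: if_splits)
  have upd_le: "\<forall>b j. upd a 0 i r b j \<le> M" if "\<forall>a i. r a i \<le> M" "i \<le> M" for i r
    using that by (auto simp: upd_apply)
  \<comment> \<open>Each iteration costs 5 units for the test and 15 for the decrement besides the
    body; the final 5 units are the failing test.\<close>
  have iterate: "(\<exists>t. exec ?w (upd a 0 i r) t (loop a (run p) i r)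
        \<and> t \<le> i * (poly (time p) N + 20) * bits M + 5 * bits M)
      \<and> (\<forall>b j. loop a (run p) i r b j \<le> M)"
    if "i \<le> s 0 k" "\<forall>a i. r a i \<le> M" "r 0 = s 0" for i r
    using that
  proof (induction i arbitrary: r)
    case 0
    let ?r = "upd a 0 0 r"
    have r: "\<forall>b j. ?r b j \<le> M" using 0 by (intro upd_le) auto
    have "exec ?w ?r (cost ?e ?r + bits (val ?e ?r)) ?r"
      by (intro exec.WhileFalse) (simp add: upd_apply)
    moreover have "cost ?e ?r + bits (val ?e ?r) \<le> 5 * bits M"
      using cost_le[where e = ?e, OF Loop.prems(2) r] bits_val_le[where e = ?e, OF Loop.prems(2) r]
      by (simp add: upd_apply)
    ultimately show ?case using r by auto
  next
    case (Suc i)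
    let ?r = "upd a 0 (Suc i) r"
    have "Suc i \<le> M"
      using Suc.prems(1) Loop.prems(4) by (meson less_imp_le le_trans)
    then have r: "\<forall>b j. ?r b j \<le> M" using Suc.prems by (intro upd_le) auto
    have r0: "?r 0 = s 0" using Suc.prems a by (simp add: upd_apply)
    obtain t where t: "exec (compile p) ?r t (run p ?r)" "t \<le> poly (time p) N * bits M"
      and q: "\<forall>a i. run p ?r a i \<le> M"
      using body[OF r r0] Suc.prems(1) by auto
    let ?q = "run p ?r"
    have q0: "?q 0 = s 0" using run_frame[OF a(3), of ?r] r0 by simp
    have qa: "?q a = ?r a" using run_frame[OF a(2)] .
    let ?t = "cost (Const 0) ?q + cost (Minus ?e (Const 1)) ?q
      + bits (val (Const 0) ?q) + bits (val (Minus ?e (Const 1)) ?q)"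
    have "exec ?d ?q ?t (upd a 0 i ?q)"
      using exec.Assign[of a "Const 0" "Minus ?e (Const 1)" ?q] qa
      by (simp add: upd_def)
    moreover have "?t \<le> 15 * bits M"
      using cost_le[where e = "Const 0", OF Loop.prems(2) q]
        bits_val_le[where e = "Const 0", OF Loop.prems(2) q]
        cost_le[where e = "Minus ?e (Const 1)", OF Loop.prems(2) q]
        bits_val_le[where e = "Minus ?e (Const 1)", OF Loop.prems(2) q]
      by simp
    moreover obtain t' where t': "exec ?w (upd a 0 i ?q) t' (loop a (run p) i ?q)"
      "t' \<le> i * (poly (time p) N + 20) * bits M + 5 * bits M"
      and l: "\<forall>b j. loop a (run p) i ?q b j \<le> M"
      using Suc.IH[of ?q] Suc.prems(1) q q0 by auto
    ultimately have "exec ?w ?r (cost ?e ?r + bits (val ?e ?r) + (t + ?t) + t')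
        (loop a (run p) (Suc i) r)"
      using t(1) unfolding loop.simps
      by (intro exec.WhileTrue[OF _ exec.Seq]) (auto simp: upd_apply)
    moreover have "cost ?e ?r + bits (val ?e ?r) \<le> 5 * bits M"
      using cost_le[where e = ?e, OF Loop.prems(2) r] bits_val_le[where e = ?e, OF Loop.prems(2) r]
      by (simp add: upd_apply)
    then have "cost ?e ?r + bits (val ?e ?r) + (t + ?t) + t'
        \<le> Suc i * (poly (time p) N + 20) * bits M + 5 * bits M"
      using \<open>?t \<le> 15 * bits M\<close> t(2) t'(2) by (simp add: add_mult_distrib)
    ultimately show ?case using l by auto
  qed
  obtain t where t: "exec ?w (upd a 0 (s 0 k) s) t (run (Loop a k p) s)"
      "t \<le> s 0 k * (poly (time p) N + 20) * bits M + 5 * bits M"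
    and l: "\<forall>b j. run (Loop a k p) s b j \<le> M"
    using iterate[of "s 0 k" s] Loop.prems by auto
  let ?f = "Cell 0 (Const k)"
  let ?t = "cost (Const 0) s + cost ?f s + bits (val (Const 0) s) + bits (val ?f s)"
  have "exec (Assign a (Const 0) ?f) s ?t (upd a 0 (s 0 k) s)"
    using exec.Assign[of a "Const 0" ?f s] by (simp add: upd_def)
  then have "exec (compile (Loop a k p)) s (?t + t) (run (Loop a k p) s)"
    using t(1) by (auto intro: exec.Seq)
  moreover have "?t \<le> (2 * k + 6) * bits M"
    using cost_le[where e = "Const 0", OF Loop.prems(2,3)]
      bits_val_le[where e = "Const 0", OF Loop.prems(2,3)]
      cost_le[where e = ?f, OF Loop.prems(2,3)] bits_val_le[where e = ?f, OF Loop.prems(2,3)]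
    by (simp add: add_mult_distrib)
  moreover have "s 0 k \<le> N"
    using Loop.prems by (auto split: if_splits)
  then have "s 0 k * (poly (time p) N + 20) * bits M \<le> N * (poly (time p) N + 20) * bits M"
    by (intro mult_le_mono) auto
  ultimately have "?t + t \<le> poly (time (Loop a k p)) N * bits M"
    using t(2) by (simp add: add_mult_distrib algebra_simps)
  with l show ?case
    using \<open>exec (compile (Loop a k p)) s (?t + t) (run (Loop a k p) s)\<close> by blast
qed

section \<open>Running time in terms of the size of the input\<close>

text \<open>The unit that \<open>bits\<close> adds for each entry pays for the factor 2 in
  \<open>2 ^ a + 2 ^ b \<le> 2 * (2 ^ a * 2 ^ b)\<close>.\<close>

lemma sum_list_less_power_bit_size: "sum_list xs < 2 ^ bit_size xs"
proof (induction xs)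
  case (Cons x xs)
  have "x + sum_list xs < 2 ^ floorlog 2 x + 2 ^ bit_size xs"
    using Cons floorlog_2_less[of x] by linarith
  also have "\<dots> \<le> 2 ^ (Suc (floorlog 2 x) + bit_size xs)"
  proof -
    have "a + b \<le> 2 * (a * b)" if "1 \<le> a" "1 \<le> b" for a b :: nat
      using that by (cases a; cases b) auto
    then show ?thesis by (simp add: power_add)
  qed
  finally show ?case by (simp add: bit_size_def bits_def)
qed (simp add: bit_size_def)

lemma length_le_bit_size: "length xs \<le> bit_size xs"
proof (induction xs)
  case (Cons x xs)
  then show ?case using bits_pos[of x] by (simp add: bit_size_def)
qed simp

lemma bit_size_map_le:
  "(\<And>x. x \<in> set xs \<Longrightarrow> bits (f x) \<le> b) \<Longrightarrow> bit_size (map f xs) \<le> length xs * b"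
  unfolding bit_size_def by (induction xs) (simp_all add: add_mono)

text \<open>The bound \<open>2 ^ Suc (bit_size xs)\<close> on the cells is at least 2, lies strictly
  above all input numbers, and has \<open>bits\<close> at most \<open>bit_size xs + 3\<close>,
  whence the factor \<open>[:3, 1:]\<close>. The second claim serves to bound the size of the
  output.\<close>

lemma exec_compile_init:
  assumes "legal False p" "init xs 0 1 \<le> bit_size xs"
    and "init xs 0 1 \<noteq> 0 \<Longrightarrow> init xs 0 0 \<le> bit_size xs"
  shows "\<exists>t. exec (compile p) (init xs) t (run p (init xs)) \<and>
    t \<le> poly (time p * [:3, 1:]) (bit_size xs)"
    and "run p (init xs) a i \<le> 2 ^ Suc (bit_size xs)"
proof -
  let ?M = "2 ^ Suc (bit_size xs) :: nat"
  have in_xs: "init xs a i < 2 ^ bit_size xs" for a i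
  proof (cases "a = 0 \<and> i < length xs")
    case True
    then show ?thesis
      using order.strict_trans1[OF member_le_sum_list sum_list_less_power_bit_size, of "xs ! i" xs]
      by (simp add: init_def)
  qed (auto simp: init_def)
  have b: "bits ?M \<le> 3 + bit_size xs"
    unfolding bits_def using floorlog_2_le[of ?M "Suc (Suc (bit_size xs))"] by simp
  have lt: "\<forall>i. init xs 0 i < ?M" and le: "\<forall>a i. init xs a i \<le> ?M"
    using order.strict_trans[OF in_xs, of ?M] by (simp_all add: less_imp_le)
  have M: "2 \<le> ?M" by simp
  note E = exec_compile[OF assms(1) M le lt assms(2,3)]
  from E show "run p (init xs) a i \<le> ?M" by blast
  from E obtain t where "exec (compile p) (init xs) t (run p (init xs))"
    "t \<le> poly (time p) (bit_size xs) * bits ?M" by blast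
  moreover from this(2) have "t \<le> poly (time p) (bit_size xs) * (3 + bit_size xs)"
    using b by (meson le_trans mult_le_mono2)
  moreover have "poly (time p) (bit_size xs) * (3 + bit_size xs)
      = poly (time p * [:3, 1:]) (bit_size xs)"
    by (simp add: algebra_simps)
  ultimately show "\<exists>t. exec (compile p) (init xs) t (run p (init xs)) \<and>
      t \<le> poly (time p * [:3, 1:]) (bit_size xs)"
    by metis
qed

section \<open>Partial exchanges\<close>

text \<open>\<open>ow z\<close> is the owner of \<open>z\<close>: assignments are treated as owner
  functions, of which only the values on \<open>{1..m}\<close> matter.\<close>

locale allocation =
  fixes n m :: nat and u :: "nat \<Rightarrow> nat \<Rightarrow> rat" and ow :: "nat \<Rightarrow> nat" and \<alpha> \<beta> :: rat
  assumes less: "\<beta> < \<alpha>" and nonneg: "0 \<le> \<beta>"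
    and bivalued: "\<And>i z. i \<in> {1..n} \<Longrightarrow> z \<in> {1..m} \<Longrightarrow> u i z = \<alpha> \<or> u i z = \<beta>"
    and ow_in: "\<And>z. z \<in> {1..m} \<Longrightarrow> ow z \<in> {1..n}"
begin

definition worth :: "nat \<Rightarrow> (nat \<Rightarrow> nat) \<Rightarrow> rat" where
  "worth i q = (\<Sum>z\<in>{1..m}. if q z = i then u i z else 0)"

definition dominating :: "(nat \<Rightarrow> nat) \<Rightarrow> bool" where
  "dominating q \<longleftrightarrow> (\<forall>z\<in>{1..m}. q z \<in> {1..n}) \<and>
     (\<forall>i\<in>{1..n}. worth i ow \<le> worth i q) \<and> (\<exists>i\<in>{1..n}. worth i ow < worth i q)"

lemma utility_bounds: "i \<in> {1..n} \<Longrightarrow> z \<in> {1..m} \<Longrightarrow> \<beta> \<le> u i z \<and> u i z \<le> \<alpha>"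
  using bivalued[of i z] less by auto

lemma worth_upd:
  assumes "z \<in> {1..m}" "q z = j" "j \<noteq> l"
  shows "worth k (q(z := l)) =
    (if k = l then worth k q + u l z else if k = j then worth k q - u j z else worth k q)"
proof -
  have *: "worth k q' = (\<Sum>y\<in>{1..m} - {z}. if q' y = k then u k y else 0) +
      (if q' z = k then u k z else 0)" for q'
    unfolding worth_def using assms(1) by (simp add: sum.remove add.commute)
  show ?thesis
    unfolding *[of "q(z := l)"] *[of q] using assms(2,3) by (auto intro!: sum.cong)
qed

lemma worth_cong: "(\<And>z. z \<in> {1..m} \<Longrightarrow> q z = q' z) \<Longrightarrow> worth k q = worth k q'"
  unfolding worth_def by (intro sum.cong) auto

section \<open>Passing a surplus along\<close>

text \<open>
  The partial exchanges: \<open>j\<close> holds a surplus worth \<open>\<alpha>\<close>, and only the owner \<open>ow x\<close> of the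
  object \<open>x\<close> given away first may have lost, namely \<open>\<beta>\<close>.
\<close>

definition surplus :: "nat \<Rightarrow> nat \<Rightarrow> (nat \<Rightarrow> nat) \<Rightarrow> bool" where
  "surplus x j q \<longleftrightarrow> u (ow x) x = \<beta> \<and> j \<noteq> ow x \<and> (\<forall>z\<in>{1..m}. q z \<in> {1..n}) \<and>
     (\<forall>l\<in>{1..n} - {ow x}. worth l ow \<le> worth l q) \<and>
     worth j ow + \<alpha> \<le> worth j q \<and> worth (ow x) ow - \<beta> \<le> worth (ow x) q"

lemma surplus_cong: "surplus x j q \<Longrightarrow> (\<And>z. z \<in> {1..m} \<Longrightarrow> q z = q' z) \<Longrightarrow> surplus x j q'"
  unfolding surplus_def using worth_cong[of q q'] by auto

lemma wasted_values:
  assumes "x \<in> {1..m}" "j \<in> {1..n}" "u (ow x) x < u j x"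
  shows "u (ow x) x = \<beta>" "u j x = \<alpha>" "j \<noteq> ow x"
  using assms bivalued[of j x] bivalued[OF ow_in, of x x] less by auto

lemma ball_ow_in: "\<forall>z\<in>{1..m}. ow z \<in> {1..n}"
  using ow_in by blast

text \<open>The object must be worth \<open>\<beta>\<close> to its owner and \<open>\<alpha>\<close>
  to \<open>j\<close>, so moving it costs the one \<open>\<beta>\<close>, brings the other
  \<open>\<alpha>\<close>, and concerns nobody else.\<close>

lemma surplus_start:
  assumes "x \<in> {1..m}" "j \<in> {1..n}" "u (ow x) x < u j x"
  shows "surplus x j (ow(x := j))"
  using wasted_values[OF assms] assms ow_in[OF assms(1)] nonneg less ball_ow_in
  unfolding surplus_def
  by (auto simp: worth_upd[where q = ow and j = "ow x", OF assms(1) refl])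

text \<open>Giving \<open>z\<close> away costs \<open>j\<close> at most \<open>\<alpha>\<close>,
  which the surplus covers, and brings \<open>l\<close> exactly \<open>\<alpha>\<close>. The agent
  \<open>ow x\<close> is excluded since his deficit could eat into this gain.\<close>

lemma surplus_pass:
  assumes "surplus x j q" "j \<in> {1..n}" "z \<in> {1..m}" "q z = j" "l \<in> {1..n}" "l \<noteq> ow x"
    "l \<noteq> j" "u l z = \<alpha>"
  shows "surplus x l (q(z := l))"
proof -
  have "worth l ow \<le> worth l q"
    using assms(1,5,6) unfolding surplus_def by auto
  then have "worth l ow \<le> worth l q + \<alpha>" using less nonneg by linarith
  then show ?thesis
    using assms(1,2,5-8) utility_bounds[OF assms(2,3)]
    unfolding surplus_def
    by (auto simp: worth_upd[where q = q, OF assms(3,4) assms(7)[symmetric]])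
qed

lemma surplus_dominating:
  assumes "surplus x j q" "x \<in> {1..m}" "j \<in> {1..n}" "\<beta> = 0"
  shows "dominating q"
proof -
  have "worth l ow \<le> worth l q" if "l \<in> {1..n}" for l
    using assms(1,4) that unfolding surplus_def by (cases "l = ow x") auto
  moreover have "worth j ow < worth j q"
    using assms(1) less nonneg unfolding surplus_def by auto
  ultimately show ?thesis using assms(1,3) unfolding dominating_def surplus_def by blast
qed

text \<open>Any object makes up for the loss of \<open>\<beta>\<close>, and the surplus pays for any
  object. The strict gain is that of \<open>j\<close> if \<open>z\<close> is worth only
  \<open>\<beta>\<close> to him, and that of \<open>ow x\<close> if \<open>z\<close> is worth
  \<open>\<alpha>\<close> to him.\<close>

lemma surplus_return_dominating:
  assumes "surplus x j q" "x \<in> {1..m}" "j \<in> {1..n}" "z \<in> {1..m}" "q z = j"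
    "u j z \<noteq> \<alpha> \<or> u (ow x) z = \<alpha>"
  shows "dominating (q(z := ow x))"
proof -
  have j: "j \<noteq> ow x" using assms(1) unfolding surplus_def by blast
  note w = worth_upd[where q = q, OF assms(4,5) j]
  have i: "ow x \<in> {1..n}" using ow_in assms(2) by blast
  have b: "\<beta> \<le> u j z" "u j z \<le> \<alpha>" "\<beta> \<le> u (ow x) z"
    using utility_bounds[OF assms(3,4)] utility_bounds[OF i assms(4)] by auto
  have s: "\<And>l. l \<in> {1..n} \<Longrightarrow> l \<noteq> ow x \<Longrightarrow> worth l ow \<le> worth l q"
    "worth j ow + \<alpha> \<le> worth j q" "worth (ow x) ow - \<beta> \<le> worth (ow x) q"
    "\<And>y. y \<in> {1..m} \<Longrightarrow> q y \<in> {1..n}"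
    using assms(1) unfolding surplus_def by auto
  have wj: "worth j (q(z := ow x)) = worth j q - u j z"
    and wi: "worth (ow x) (q(z := ow x)) = worth (ow x) q + u (ow x) z"
    and wl: "l \<noteq> ow x \<Longrightarrow> l \<noteq> j \<Longrightarrow> worth l (q(z := ow x)) = worth l q" for l
    using w j by auto
  have "worth l ow \<le> worth l (q(z := ow x))" if "l \<in> {1..n}" for l
  proof -
    consider "l = ow x" | "l = j" | "l \<noteq> ow x" "l \<noteq> j" by blast
    then show ?thesis
    proof cases
      case 1
      then show ?thesis using s(3) b wi by simp
    next
      case 2
      then show ?thesis using s(2) b wj by simp
    next
      case 3
      then show ?thesis using s(1) that wl by simp
    qed
  qed
  moreover have "worth j ow < worth j (q(z := ow x)) \<or>
      worth (ow x) ow < worth (ow x) (q(z := ow x))"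
  proof (cases "u j z = \<alpha>")
    case True
    then show ?thesis using assms(6) s(3) less wi by simp
  next
    case False
    then show ?thesis using b s(2) wj by simp
  qed
  ultimately show ?thesis using assms(3) i s(4) unfolding dominating_def by auto
qed

section \<open>Certificates of optimality\<close>

text \<open>What a failed search from \<open>x\<close> leaves behind, \<open>R\<close> being the
  agents reached: it is closed under passing objects on and contains all who like \<open>x\<close>
  more than its owner. The last conjunct keeps the weight \<open>\<beta> / \<alpha>\<close>
  positive.\<close>

definition blocks :: "nat set \<Rightarrow> nat \<Rightarrow> bool" where
  "blocks R x \<longleftrightarrow> R \<subseteq> {1..n} \<and> (\<forall>l\<in>{1..n}. u (ow x) x < u l x \<longrightarrow> l \<in> R) \<and>
     (\<forall>z\<in>{1..m}. ow z \<in> R \<longrightarrow> u (ow z) z = \<alpha> \<and> (\<forall>l\<in>{1..n}. u l z = \<alpha> \<longrightarrow> l \<in> R)) \<and>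
     (R \<noteq> {} \<longrightarrow> \<beta> \<noteq> 0)"

text \<open>Closure passes to unions, so the certificates of all objects combine into one set
  \<open>S\<close> of agents of weight \<open>\<beta> / \<alpha>\<close>. As weights are positive, a
  Pareto improvement would raise the weighted welfare, but no object has a larger weighted value for
  anyone than for its owner.\<close>

lemma not_dominating_if_blocked:
  assumes "\<forall>x\<in>{1..m}. \<exists>R. blocks R x"
  shows "\<not> dominating q"
proof
  assume dom: "dominating q"
  from bchoice[OF assms] obtain R where R: "\<And>x. x \<in> {1..m} \<Longrightarrow> blocks (R x) x" by blast
  define S where "S = (\<Union>x\<in>{1..m}. R x)"
  define w where "w l = (if l \<in> S then \<beta> / \<alpha> else 1)" for l
  have "0 < \<alpha>" using less nonneg by simp
  have S: "\<beta> > 0" if "l \<in> S" for l using R that nonneg unfolding S_def blocks_def by force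
  have wasted: "l \<in> S" if "x \<in> {1..m}" "l \<in> {1..n}" "u (ow x) x < u l x" for x l
    using R that unfolding S_def blocks_def by blast
  have closed: "u (ow z) z = \<alpha>" "l \<in> {1..n} \<Longrightarrow> u l z = \<alpha> \<Longrightarrow> l \<in> S"
    if "z \<in> {1..m}" "ow z \<in> S" for z l
    using R that unfolding S_def blocks_def by blast+
  have pos: "0 < w l" for l
    using S[of l] \<open>0 < \<alpha>\<close> unfolding w_def by simp
  have q: "q z \<in> {1..n}" if "z \<in> {1..m}" for z using dom that unfolding dominating_def by blast
  have welfare: "(\<Sum>l\<in>{1..n}. w l * worth l f) = (\<Sum>z\<in>{1..m}. w (f z) * u (f z) z)"
    if "\<And>z. z \<in> {1..m} \<Longrightarrow> f z \<in> {1..n}" for f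
  proof -
    have "(\<Sum>l\<in>{1..n}. w l * worth l f) =
        (\<Sum>z\<in>{1..m}. \<Sum>l\<in>{1..n}. if f z = l then w l * u l z else 0)"
      unfolding worth_def sum_distrib_left
      by (subst sum.swap) (intro sum.cong; simp)
    also have "\<dots> = (\<Sum>z\<in>{1..m}. w (f z) * u (f z) z)"
      using that by (intro sum.cong refl) (simp add: sum.delta)
    finally show ?thesis .
  qed
  have "(\<Sum>l\<in>{1..n}. w l * worth l ow) < (\<Sum>l\<in>{1..n}. w l * worth l q)"
    using dom pos unfolding dominating_def
    by (intro sum_strict_mono_ex1) (auto simp: mult_le_cancel_left_pos)
  also have "\<dots> = (\<Sum>z\<in>{1..m}. w (q z) * u (q z) z)" by (rule welfare[OF q])
  also have "\<dots> \<le> (\<Sum>z\<in>{1..m}. w (ow z) * u (ow z) z)"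
  proof (rule sum_mono)
    fix z assume z: "z \<in> {1..m}"
    note b = bivalued[OF q[OF z] z] bivalued[OF ow_in[OF z] z]
    \<comment> \<open>For members of \<open>S\<close> the weight scales \<open>\<alpha>\<close> down
      to \<open>\<beta>\<close>.\<close>
    have "w (q z) * u (q z) z \<le> \<beta>" if "q z \<in> S \<or> u (q z) z = \<beta>"
    proof (cases "q z \<in> S")
      case True
      have "\<beta> / \<alpha> * u (q z) z \<le> \<beta> / \<alpha> * \<alpha>"
        using utility_bounds[OF q[OF z] z] nonneg \<open>0 < \<alpha>\<close> by (intro mult_left_mono) auto
      then show ?thesis using True \<open>0 < \<alpha>\<close> unfolding w_def by simp
    next
      case False
      then show ?thesis using that unfolding w_def by simp
    qed
    moreover have "w (ow z) * u (ow z) z = (if ow z \<in> S then \<beta> else u (ow z) z)"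
      using closed(1)[OF z] \<open>0 < \<alpha>\<close> unfolding w_def by simp
    moreover have "w (q z) * u (q z) z \<le> \<alpha>"
      using calculation(1) b less unfolding w_def by auto
    \<comment> \<open>If the owner contributes only \<open>\<beta>\<close>, an agent with value
      \<open>\<alpha>\<close> for \<open>z\<close> is in \<open>S\<close>: by closure if the owner
      is in \<open>S\<close>, and otherwise because he likes \<open>z\<close> more.\<close>
    moreover have "q z \<in> S \<or> u (q z) z = \<beta>" if "ow z \<in> S \<or> u (ow z) z = \<beta>"
      using that closed(2)[OF z _ q[OF z]] wasted[OF z q[OF z]] b less by auto
    ultimately show "w (q z) * u (q z) z \<le> w (ow z) * u (ow z) z"
      using b by auto
  qed
  also have "\<dots> = (\<Sum>l\<in>{1..n}. w l * worth l ow)" by (rule welfare[OF ow_in, symmetric])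
  finally show False by simp
qed

end

section \<open>The search\<close>

text \<open>The index of \<open>I\<close> is the number of iterations still to come, which the
  counter exceeds by one in the conclusion for the body. \<open>I\<close> has to survive arbitrary
  writes to the counter cell.\<close>

lemma loop_rule:
  assumes "I N s"
    and "\<And>i s v. I i s \<Longrightarrow> I i (upd a 0 v s)"
    and "\<And>i s. i < N \<Longrightarrow> I (Suc i) s \<Longrightarrow> s a 0 = Suc i \<Longrightarrow> I i (F s)"
  shows "I 0 (loop a F N s)"
proof -
  have "I 0 (loop a F i s)" if "i \<le> N" "I i s" for i s
    using that by (induction i arbitrary: s) (simp_all add: assms(2,3) upd_apply)
  then show ?thesis using assms(1) by blast
qed

section \<open>Addresses in the encoded input, and the program\<close>

definition cur :: "nat \<Rightarrow> exp" where "cur a = Cell a (Const 0)"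

definition num_objects :: exp where "num_objects = Cell 0 (Const 1)"

text \<open>The fraction for agent \<open>i\<close> and object \<open>z\<close> starts at
  \<open>2 + 2 * ((i - 1) * m + (z - 1))\<close>; the header \<open>[n, m]\<close> absorbs the shift
  of \<open>z\<close>.\<close>

definition position :: "exp \<Rightarrow> exp \<Rightarrow> exp" where
  "position e f = Times (Const 2) (Plus (Times (Minus e (Const 1)) num_objects) f)"

definition numer :: "exp \<Rightarrow> exp \<Rightarrow> exp" where
  "numer e f = Cell 0 (position e f)"

definition denom :: "exp \<Rightarrow> exp \<Rightarrow> exp" where
  "denom e f = Cell 0 (Plus (position e f) (Const 1))"

text \<open>The owners follow the header and the \<open>2 * n * m\<close> entries of the utilities,
  which puts object \<open>z\<close> at \<open>2 * n * m + z + 1\<close>.\<close>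

definition owner :: "exp \<Rightarrow> exp" where
  "owner f = Cell 0 (Plus (Times (Const 2) (Times (Cell 0 (Const 0)) num_objects)) (Plus f (Const 1)))"

definition share :: "exp \<Rightarrow> exp \<Rightarrow> exp" where
  "share e f = Plus (Times e num_objects) f"

definition neg :: "exp \<Rightarrow> exp" where "neg e = Minus (Const 1) e"

definition equal :: "exp \<Rightarrow> exp \<Rightarrow> exp" where
  "equal e f = neg (Plus (Minus e f) (Minus f e))"

text \<open>
  Array \<open>2\<close> holds one assignment per agent, array \<open>3\<close> marks an agent \<open>l\<close> with the object \<open>x\<close>
  whose search reached \<open>l\<close> last. The counters are \<open>4\<close> (the object \<open>x\<close>), \<open>5\<close> (rounds),
  \<open>6\<close> and \<open>8\<close> (agents), \<open>7\<close> and \<open>9\<close> (objects).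
\<close>

definition wants :: "exp \<Rightarrow> exp \<Rightarrow> exp" where
  "wants e f = Minus (Times (numer e f) (denom (owner (cur 4)) (cur 4)))
     (Times (numer (owner (cur 4)) (cur 4)) (denom e f))"

text \<open>Cell 0 receives the length \<open>m + 1\<close>, cell 1 keeps the 0 that announces an
  improvement, and object \<open>z\<close> has its new owner in cell \<open>z + 1\<close>.\<close>

definition emit :: prog where
  "emit = Then
     (Loop 9 1 (Put 1 (Plus (cur 9) (Const 1)) (Cell 2 (share (cur 6) (cur 9)))))
     (Put 1 (Const 0) (Plus num_objects (Const 1)))"

text \<open>Agent \<open>cur a\<close> becomes a holder of the surplus. His row is copied from
  \<open>e\<close>, with counter 9 running over the objects, and then object \<open>f\<close> is
  moved to him.\<close>

definition enlist :: "exp \<Rightarrow> nat \<Rightarrow> exp \<Rightarrow> prog" where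
  "enlist e a f = Then (Put 3 (cur a) (cur 4))
     (Then (Loop 9 1 (Put 2 (share (cur a) (cur 9)) e)) (Put 2 (share (cur a) f) (cur a)))"

definition seed :: prog where
  "seed = When (wants (cur 6) (cur 4))
     (Then (enlist (owner (cur 9)) 6 (cur 4))
       (When (neg (numer (owner (cur 4)) (cur 4))) emit))"

text \<open>The concluding exchange: the row of the holder \<open>cur 6\<close> is emitted, and
  object \<open>cur 7\<close> is returned to the owner of \<open>x\<close> in the output.\<close>

definition finish :: prog where
  "finish = When (Plus (neg (wants (cur 6) (cur 7))) (wants (owner (cur 4)) (cur 7)))
     (Then emit (Put 1 (Plus (cur 7) (Const 1)) (owner (cur 4))))"

definition pass :: prog where
  "pass = When (neg (equal (Cell 3 (cur 8)) (cur 4)))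
     (When (neg (equal (cur 8) (owner (cur 4))))
       (When (wants (cur 8) (cur 7))
         (enlist (Cell 2 (share (cur 6) (cur 9))) 8 (cur 7))))"

definition visit :: prog where
  "visit = When (equal (Cell 3 (cur 6)) (cur 4))
     (When (equal (Cell 2 (share (cur 6) (cur 7))) (cur 6))
       (Then finish (Loop 8 0 pass)))"

definition search :: prog where
  "search = Then (Loop 6 0 seed) (Loop 5 0 (Loop 6 0 (Loop 7 1 visit)))"

definition improve :: prog where
  "improve = Then (Loop 4 1 search)
     (When (neg (Cell 1 (Const 0)))
       (Then (Put 1 (Const 0) (Const 1)) (Put 1 (Const 1) (Const 1))))"

lemmas prog_defs = cur_def num_objects_def position_def numer_def denom_def owner_def share_def
  neg_def equal_def wants_def emit_def enlist_def seed_def finish_def pass_def visit_def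
  search_def improve_def

lemma legal_improve: "legal False improve"
  unfolding prog_defs by simp

lemma val_cur [simp]: "val (cur a) s = s a 0"
  unfolding cur_def by simp

lemma val_neg [simp]: "val (neg e) s = (if val e s = 0 then 1 else 0)"
  unfolding neg_def by simp

lemma val_equal [simp]: "val (equal e f) s = (if val e s = val f s then 1 else 0)"
  unfolding equal_def by simp

section \<open>Reading the input\<close>

locale allocation_input = allocation +
  fixes inp :: "nat \<Rightarrow> nat"
  assumes inp_0: "inp 0 = n" and inp_1: "inp (Suc 0) = m"
    and inp_numer: "\<And>i z. i \<in> {1..n} \<Longrightarrow> z \<in> {1..m} \<Longrightarrow>
      inp (2 * ((i - 1) * m + z)) = nat (fst (quotient_of (u i z)))"
    and inp_denom: "\<And>i z. i \<in> {1..n} \<Longrightarrow> z \<in> {1..m} \<Longrightarrow>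
      inp (Suc (2 * ((i - 1) * m + z))) = nat (snd (quotient_of (u i z)))"
    and inp_owner: "\<And>z. z \<in> {1..m} \<Longrightarrow> inp (2 * (n * m) + Suc z) = ow z"
begin

lemma val_num_objects [simp]: "s 0 = inp \<Longrightarrow> val num_objects s = m"
  unfolding num_objects_def by (simp add: inp_1)

lemma val_share [simp]: "s 0 = inp \<Longrightarrow> val (share e f) s = val e s * m + val f s"
  unfolding share_def by simp

lemma val_owner: "s 0 = inp \<Longrightarrow> val f s \<in> {1..m} \<Longrightarrow> val (owner f) s = ow (val f s)"
  using inp_owner[of "val f s"] unfolding owner_def by (simp add: inp_0)

lemma val_numer: "s 0 = inp \<Longrightarrow> val e s \<in> {1..n} \<Longrightarrow> val f s \<in> {1..m} \<Longrightarrow>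
    val (numer e f) s = nat (fst (quotient_of (u (val e s) (val f s))))"
  using inp_numer[of "val e s" "val f s"] unfolding numer_def position_def by simp

lemma val_denom: "s 0 = inp \<Longrightarrow> val e s \<in> {1..n} \<Longrightarrow> val f s \<in> {1..m} \<Longrightarrow>
    val (denom e f) s = nat (snd (quotient_of (u (val e s) (val f s))))"
  using inp_denom[of "val e s" "val f s"] unfolding denom_def position_def by simp

lemma nat_quotient:
  assumes "0 \<le> r"
  shows "r = of_nat (nat (fst (quotient_of r))) / of_nat (nat (snd (quotient_of r)))"
    "0 < nat (snd (quotient_of r))"
proof -
  obtain a b where q: "quotient_of r = (a, b)" by fastforce
  have "0 < b" using quotient_of_denom_pos[OF q] .
  moreover have "r = of_int a / of_int b" using quotient_of_div[OF q] .
  moreover from this have "0 \<le> a"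
    using assms \<open>0 < b\<close> by (simp add: zero_le_divide_iff)
  ultimately show "r = of_nat (nat (fst (quotient_of r))) / of_nat (nat (snd (quotient_of r)))"
    "0 < nat (snd (quotient_of r))"
    using q by auto
qed

lemma nonneg_utility: "i \<in> {1..n} \<Longrightarrow> z \<in> {1..m} \<Longrightarrow> 0 \<le> u i z"
  using utility_bounds[of i z] nonneg by auto

lemma val_numer_eq_0:
  assumes "s 0 = inp" "val e s \<in> {1..n}" "val f s \<in> {1..m}"
  shows "val (numer e f) s = 0 \<longleftrightarrow> u (val e s) (val f s) = 0"
proof -
  let ?r = "u (val e s) (val f s)"
  have "?r = of_nat (nat (fst (quotient_of ?r))) / of_nat (nat (snd (quotient_of ?r)))"
    "0 < nat (snd (quotient_of ?r))"
    using nat_quotient nonneg_utility assms(2,3) by blast+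
  then show ?thesis
    unfolding val_numer[OF assms] by (metis div_0 divide_eq_0_iff of_nat_0_eq_iff less_irrefl)
qed

text \<open>Fractions are compared by cross multiplication, truncated subtraction being nonzero
  exactly for a strict inequality. If \<open>u (ow x) x = \<beta>\<close>, the test recognises the
  value \<open>\<alpha>\<close>, so the program works without knowing \<open>\<alpha>\<close> and
  \<open>\<beta>\<close>.\<close>

lemma val_wants:
  assumes "s 0 = inp" "val e s \<in> {1..n}" "val f s \<in> {1..m}" "s 4 0 = x" "x \<in> {1..m}"
  shows "val (wants e f) s \<noteq> 0 \<longleftrightarrow> u (ow x) x < u (val e s) (val f s)"
proof -
  let ?o = "owner (cur 4)"
  have x: "val ?o s = ow x" "ow x \<in> {1..n}"
    using val_owner[where s = s and f = "cur 4"] assms(1) ow_in assms(4,5) by auto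
  define r r' where "r = u (ow x) x" and "r' = u (val e s) (val f s)"
  define a b a' b' where "a = nat (fst (quotient_of r))" and "b = nat (snd (quotient_of r))"
    and "a' = nat (fst (quotient_of r'))" and "b' = nat (snd (quotient_of r'))"
  have "0 \<le> r" "0 \<le> r'"
    unfolding r_def r'_def using nonneg_utility assms(2,3,5) x(2) by blast+
  then have r: "r = of_nat a / of_nat b" "0 < b" "r' = of_nat a' / of_nat b'" "0 < b'"
    unfolding a_def b_def a'_def b'_def using nat_quotient by blast+
  have "val (wants e f) s = a' * b - a * b'"
    unfolding wants_def a_def b_def a'_def b'_def r_def r'_def
    using assms x by (simp add: val_numer val_denom)
  also have "\<dots> \<noteq> 0 \<longleftrightarrow> a * b' < a' * b" by auto
  also have "\<dots> \<longleftrightarrow> (of_nat (a * b') :: rat) < of_nat (a' * b)" by (simp only: of_nat_less_iff)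
  also have "\<dots> \<longleftrightarrow> r < r'" unfolding r(1,3) using r(2,4) by (simp add: divide_simps)
  finally show ?thesis unfolding r_def r'_def .
qed

lemma dominating_cong:
  "dominating q \<Longrightarrow> (\<And>z. z \<in> {1..m} \<Longrightarrow> q z = q' z) \<Longrightarrow> dominating q'"
  unfolding dominating_def using worth_cong[of q q'] by auto

section \<open>The invariant of the search\<close>

definition row :: "state \<Rightarrow> nat \<Rightarrow> nat \<Rightarrow> nat" where
  "row s j z = s 2 (j * m + z)"

text \<open>Objects are treated in descending order, so marks left by earlier searches are larger
  than \<open>x\<close> and cannot be taken for current ones.\<close>

definition marked :: "nat \<Rightarrow> state \<Rightarrow> nat set" where
  "marked x s = {l \<in> {1..n}. s 3 l = x}"

text \<open>The search goes on after a success and may overwrite the output; a nonzero length must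
  always come with a Pareto improvement.\<close>

definition output_ok :: "(nat \<Rightarrow> nat) \<Rightarrow> bool" where
  "output_ok out \<longleftrightarrow> out 1 = 0 \<and>
     (out 0 \<noteq> 0 \<longrightarrow> out 0 = Suc m \<and> dominating (\<lambda>z. out (Suc z)))"

text \<open>A row takes objects only from \<open>ow x\<close> and from agents marked earlier, which
  gives the last clause. Through it a holder still has all objects of his own in his row when his
  turn comes.\<close>

definition sound :: "nat \<Rightarrow> state \<Rightarrow> bool" where
  "sound x s \<longleftrightarrow> s 0 = inp \<and> output_ok (s 1) \<and> (\<forall>l. s 3 l = 0 \<or> x \<le> s 3 l) \<and>
     (\<forall>j\<in>marked x s. surplus x j (row s j) \<and>
       (\<forall>z\<in>{1..m}. ow z \<noteq> ow x \<longrightarrow> ow z = j \<or> ow z \<notin> marked x s \<longrightarrow> row s j z = ow z))"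

lemma sound_cong:
  assumes "sound x s" "\<And>a. a \<in> {0, 1, 2, 3} \<Longrightarrow> s' a = s a"
  shows "sound x s'"
  using assms unfolding sound_def marked_def row_def by simp

text \<open>After the shift to \<open>z - 1 < m\<close> this is uniqueness of the quotient.\<close>

lemma index_eq:
  assumes "j * m + z = l * m + y" "z \<in> {1..m}" "y \<in> {1..m}"
  shows "j = l" "z = y"
proof -
  have "j * m + (z - 1) = l * m + (y - 1)" using assms by auto
  moreover have "z - 1 < m" "y - 1 < m" using assms by auto
  ultimately have "(j * m + (z - 1)) div m = (l * m + (y - 1)) div m" by simp
  then show "j = l" using \<open>z - 1 < m\<close> \<open>y - 1 < m\<close> by (simp add: div_add1_eq)
  then show "z = y" using assms by simp
qed

section \<open>Copying rows and adding a holder\<close>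

text \<open>The values of \<open>e\<close> and \<open>f\<close> are asked for only in states that
  agree with \<open>s\<close> outside the counter and the target cells. They may thus read other
  cells of array \<open>b\<close>, as when one row is copied to another.\<close>

lemma run_copy:
  fixes ix :: "nat \<Rightarrow> nat"
  assumes "b \<noteq> 9" "b \<noteq> 0" "s 0 = inp" "inj_on ix {1..m}"
    and "\<And>s' w. w \<in> {1..m} \<Longrightarrow> s' 9 0 = w \<Longrightarrow> (\<And>a. a \<notin> {b, 9} \<Longrightarrow> s' a = s a) \<Longrightarrow>
      (\<And>i. i \<notin> ix ` {1..m} \<Longrightarrow> s' b i = s b i) \<Longrightarrow> val e s' = ix w \<and> val f s' = g w"
  defines "s' \<equiv> run (Loop 9 1 (Put b e f)) s"
  shows "(\<forall>a. a \<notin> {b, 9} \<longrightarrow> s' a = s a) \<and> (\<forall>w\<in>{1..m}. s' b (ix w) = g w) \<and>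
    (\<forall>i. i \<notin> ix ` {1..m} \<longrightarrow> s' b i = s b i)"
proof -
  let ?I = "\<lambda>k s'. (\<forall>a. a \<notin> {b, 9} \<longrightarrow> s' a = s a) \<and>
    (\<forall>w\<in>{1..m}. k < w \<longrightarrow> s' b (ix w) = g w) \<and> (\<forall>i. i \<notin> ix ` {1..m} \<longrightarrow> s' b i = s b i)"
  have "?I 0 (loop 9 (run (Put b e f)) m s)"
  proof (rule loop_rule[where I = ?I])
    fix k r v assume "?I k r"
    then show "?I k (upd 9 0 v r)" using assms(1) by (simp add: upd_apply)
  next
    fix k r assume k: "k < m" and I: "?I (Suc k) r" and "r 9 0 = Suc k"
    then have v: "val e r = ix (Suc k)" "val f r = g (Suc k)"
      using assms(5)[of "Suc k" r] by auto
    have "ix w = ix (Suc k) \<longleftrightarrow> w = Suc k" if "w \<in> {1..m}" for w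
      using inj_onD[OF assms(4)] that k by fastforce
    then show "?I k (run (Put b e f) r)"
      using I k unfolding run.simps v upd_apply by (auto simp: Suc_lessI)
  qed auto
  then have "?I 0 s'" unfolding s'_def by (simp add: assms(3) inp_1)
  then show ?thesis by auto
qed

lemma run_emit:
  assumes "s 0 = inp" "s 6 0 = j"
  shows "a \<notin> {1, 9} \<Longrightarrow> run emit s a = s a"
    and "run emit s 1 0 = Suc m" "run emit s 1 1 = s 1 1"
    and "w \<in> {1..m} \<Longrightarrow> run emit s 1 (Suc w) = row s j w"
proof -
  let ?s = "run (Loop 9 1 (Put 1 (Plus (cur 9) (Const 1)) (Cell 2 (share (cur 6) (cur 9))))) s"
  have "(\<forall>a. a \<notin> {1, 9} \<longrightarrow> ?s a = s a) \<and> (\<forall>w\<in>{1..m}. ?s 1 (Suc w) = row s j w) \<and>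
      (\<forall>i. i \<notin> Suc ` {1..m} \<longrightarrow> ?s 1 i = s 1 i)"
    by (rule run_copy) (use assms in \<open>simp_all add: row_def\<close>)
  then have copy: "a \<notin> {1, 9} \<Longrightarrow> ?s a = s a" "w \<in> {1..m} \<Longrightarrow> ?s 1 (Suc w) = row s j w"
    "i \<notin> Suc ` {1..m} \<Longrightarrow> ?s 1 i = s 1 i" for a w i
    by blast+
  have e: "run emit s = upd 1 0 (Suc m) ?s"
    unfolding emit_def run.simps(2) using copy(1)[of 0] assms by simp
  show "a \<notin> {1, 9} \<Longrightarrow> run emit s a = s a" using copy(1)[of a] unfolding e by (simp add: upd_apply)
  show "run emit s 1 0 = Suc m" unfolding e by (simp add: upd_apply)
  show "run emit s 1 1 = s 1 1" using copy(3)[of 1] unfolding e by (auto simp: upd_apply)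
  show "w \<in> {1..m} \<Longrightarrow> run emit s 1 (Suc w) = row s j w"
    using copy(2)[of w] unfolding e by (simp add: upd_apply)
qed

lemma run_enlist:
  assumes "s 0 = inp" "s a 0 = l" "s 4 0 = x" "a \<notin> {0, 2, 3, 9}" "z \<in> {1..m}"
    and "\<And>s' w. w \<in> {1..m} \<Longrightarrow> s' 9 0 = w \<Longrightarrow> (\<And>a. a \<notin> {2, 3, 9} \<Longrightarrow> s' a = s a) \<Longrightarrow>
      (\<And>j y. j \<noteq> l \<Longrightarrow> y \<in> {1..m} \<Longrightarrow> row s' j y = row s j y) \<Longrightarrow> val e s' = g w"
    and "\<And>s'. (\<And>a. a \<notin> {2, 3, 9} \<Longrightarrow> s' a = s a) \<Longrightarrow> val f s' = z"
  defines "s' \<equiv> run (enlist e a f) s"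
  shows "(\<forall>b. b \<notin> {2, 3, 9} \<longrightarrow> s' b = s b) \<and> s' 3 = (s 3)(l := x) \<and>
    (\<forall>w\<in>{1..m}. row s' l w = (g(z := l)) w) \<and>
    (\<forall>j. j \<noteq> l \<longrightarrow> (\<forall>w\<in>{1..m}. row s' j w = row s j w))"
proof -
  let ?r = "upd 3 l x s"
  let ?s = "run (Loop 9 1 (Put 2 (share (cur a) (cur 9)) e)) ?r"
  have outside: "j * m + y \<notin> (\<lambda>w. l * m + w) ` {1..m}" if "j \<noteq> l" "y \<in> {1..m}" for j y
    using index_eq that by blast
  have "(\<forall>b. b \<notin> {2, 9} \<longrightarrow> ?s b = ?r b) \<and> (\<forall>w\<in>{1..m}. ?s 2 (l * m + w) = g w) \<and>
    (\<forall>i. i \<notin> (\<lambda>w. l * m + w) ` {1..m} \<longrightarrow> ?s 2 i = ?r 2 i)"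
  proof (rule run_copy)
    fix s' w
    assume w: "w \<in> {1..m}" "s' 9 0 = w" and eq: "\<And>a. a \<notin> {2, 9} \<Longrightarrow> s' a = ?r a"
      and out: "\<And>i. i \<notin> (\<lambda>w. l * m + w) ` {1..m} \<Longrightarrow> s' 2 i = ?r 2 i"
    have eq': "b \<notin> {2, 3, 9} \<Longrightarrow> s' b = s b" for b using eq[of b] by (simp add: upd_apply)
    have "row s' j y = row s j y" if "j \<noteq> l" "y \<in> {1..m}" for j y
      using out[OF outside[OF that]] unfolding row_def by (simp add: upd_apply)
    then have "val e s' = g w" using assms(6) w eq' by blast
    moreover have "s' 0 = inp" "s' a 0 = l" using eq' assms by auto
    ultimately show "val (share (cur a) (cur 9)) s' = l * m + w \<and> val e s' = g w"
      using w by simp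
  qed (use assms(1) in \<open>simp_all add: upd_apply inj_on_def\<close>)
  then have copy: "b \<notin> {2, 9} \<Longrightarrow> ?s b = ?r b" "w \<in> {1..m} \<Longrightarrow> ?s 2 (l * m + w) = g w"
    "i \<notin> (\<lambda>w. l * m + w) ` {1..m} \<Longrightarrow> ?s 2 i = ?r 2 i" for b w i
    by blast+
  have s0: "?s 0 = inp" and sa: "?s a 0 = l"
    using copy(1)[of 0] copy(1)[of a] assms(1,2,4) by (auto simp: upd_apply)
  have "val f ?s = z" using copy(1) by (intro assms(7)) (simp add: upd_apply)
  then have e: "s' = upd 2 (l * m + z) l ?s"
    unfolding s'_def enlist_def run.simps(1,2) using s0 sa assms(2,3) by simp
  have 1: "s' b = s b" if "b \<notin> {2, 3, 9}" for b
    using copy(1)[of b] that unfolding e by (simp add: upd_apply)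
  have 2: "s' 3 = (s 3)(l := x)" using copy(1)[of 3] unfolding e by (simp add: upd_apply)
  have 3: "row s' l w = (g(z := l)) w" if "w \<in> {1..m}" for w
    using copy(2)[of w] that unfolding e row_def by (simp add: upd_apply)
  have 4: "row s' j w = row s j w" if "j \<noteq> l" "w \<in> {1..m}" for j w
  proof -
    have "j * m + w \<noteq> l * m + z" using index_eq(1)[of j w l z] assms(5) that by blast
    moreover have "?s 2 (j * m + w) = s 2 (j * m + w)"
      using copy(3)[OF outside[OF that]] by (simp add: upd_apply)
    ultimately show ?thesis unfolding e row_def by (simp add: upd_apply)
  qed
  show ?thesis by (intro conjI allI ballI impI 1 2 3 4)
qed

text \<open>More marks only weaken the last clause of \<open>sound\<close> for the old holders,
  whose rows are untouched; for \<open>l\<close> the clause follows from \<open>keep\<close>, stated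
  for the marks before \<open>l\<close> joins.\<close>

lemma sound_extend:
  assumes "sound x s" "x \<in> {1..m}" "l \<in> {1..n}" "l \<notin> marked x s"
    and "s' 0 = s 0" "s' 1 = s 1" "s' 3 = (s 3)(l := x)"
    and row_l: "\<And>w. w \<in> {1..m} \<Longrightarrow> row s' l w = q w"
    and row_j: "\<And>j w. j \<noteq> l \<Longrightarrow> w \<in> {1..m} \<Longrightarrow> row s' j w = row s j w"
    and "surplus x l q"
    and keep: "\<And>y. y \<in> {1..m} \<Longrightarrow> ow y \<noteq> ow x \<Longrightarrow> ow y = l \<or> ow y \<notin> marked x s \<Longrightarrow> q y = ow y"
  shows "sound x s'" "marked x s' = insert l (marked x s)"
proof -
  show m: "marked x s' = insert l (marked x s)"
    using assms(3,7) unfolding marked_def by auto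
  have s: "s 0 = inp" "output_ok (s 1)" "\<And>k. s 3 k = 0 \<or> x \<le> s 3 k"
    "\<And>j. j \<in> marked x s \<Longrightarrow> surplus x j (row s j)"
    "\<And>j y. j \<in> marked x s \<Longrightarrow> y \<in> {1..m} \<Longrightarrow> ow y \<noteq> ow x \<Longrightarrow>
      ow y = j \<or> ow y \<notin> marked x s \<Longrightarrow> row s j y = ow y"
    using assms(1) unfolding sound_def by blast+
  have "surplus x j (row s' j) \<and> (\<forall>y\<in>{1..m}. ow y \<noteq> ow x \<longrightarrow>
      ow y = j \<or> ow y \<notin> marked x s' \<longrightarrow> row s' j y = ow y)" if "j \<in> marked x s'" for j
  proof (cases "j = l")
    case True
    have "surplus x l (row s' l)" using surplus_cong[OF assms(10)] row_l by metis
    then show ?thesis using True row_l keep m by auto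
  next
    case False
    then have j: "j \<in> marked x s" using that m by simp
    have "surplus x j (row s' j)" using surplus_cong[OF s(4)[OF j]] row_j False by metis
    then show ?thesis using row_j[OF False] s(5)[OF j] m by auto
  qed
  then show "sound x s'"
    using s(1-3) assms(5-7) unfolding sound_def by simp
qed

lemma marked_cong: "s' 3 = s 3 \<Longrightarrow> marked x s' = marked x s"
  unfolding marked_def by simp

lemma sound_upd: "4 \<le> a \<Longrightarrow> sound x s \<Longrightarrow> sound x (upd a i v s)"
  by (erule sound_cong) (auto simp: upd_apply)

lemma marked_upd: "4 \<le> a \<Longrightarrow> marked x (upd a i v s) = marked x s"
  by (rule marked_cong) (simp add: upd_apply)

lemma sound_0: "sound x s \<Longrightarrow> s 0 = inp"
  unfolding sound_def by blast

lemma output_okI: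
  assumes "dominating q" "\<And>z. z \<in> {1..m} \<Longrightarrow> out (Suc z) = q z" "out 0 = Suc m" "out 1 = 0"
  shows "output_ok out"
proof -
  have "dominating (\<lambda>z. out (Suc z))"
    by (rule dominating_cong[OF assms(1)]) (simp add: assms(2))
  then show ?thesis using assms(3,4) unfolding output_ok_def by simp
qed

lemma sound_output:
  assumes "sound x s" "\<And>a. a \<in> {0, 2, 3} \<Longrightarrow> s' a = s a" "output_ok (s' 1)"
  shows "sound x s'"
  using assms unfolding sound_def marked_def row_def by simp

section \<open>Seeding the search\<close>

lemma run_seed:
  assumes s: "sound x s" "s 4 0 = x" "s 6 0 = j" "j \<in> {1..n}" "x \<in> {1..m}" "j \<notin> marked x s"
  defines "s' \<equiv> run seed s"
  shows "sound x s'"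
    and "marked x s' = (if u (ow x) x < u j x then insert j (marked x s) else marked x s)"
    and "s 1 0 \<noteq> 0 \<Longrightarrow> s' 1 0 \<noteq> 0"
    and "u (ow x) x < u j x \<Longrightarrow> \<beta> = 0 \<Longrightarrow> s' 1 0 \<noteq> 0"
proof -
  note s0 = sound_0[OF s(1)]
  have w: "val (wants (cur 6) (cur 4)) s \<noteq> 0 \<longleftrightarrow> u (ow x) x < u j x"
    using val_wants[where s = s and e = "cur 6" and f = "cur 4"] s0 s by simp
  have "sound x s' \<and>
    marked x s' = (if u (ow x) x < u j x then insert j (marked x s) else marked x s) \<and>
    (s 1 0 \<noteq> 0 \<longrightarrow> s' 1 0 \<noteq> 0) \<and> (u (ow x) x < u j x \<longrightarrow> \<beta> = 0 \<longrightarrow> s' 1 0 \<noteq> 0)"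
  proof (cases "u (ow x) x < u j x")
    case False
    then have "s' = s" using w unfolding s'_def seed_def by simp
    then show ?thesis using False s by simp
  next
    case True
    note vals = wasted_values[OF s(5,4) True]
    let ?q = "ow(x := j)"
    let ?r = "run (enlist (owner (cur 9)) 6 (cur 4)) s"
    have "(\<forall>b. b \<notin> {2, 3, 9} \<longrightarrow> ?r b = s b) \<and> ?r 3 = (s 3)(j := x) \<and>
      (\<forall>w\<in>{1..m}. row ?r j w = ?q w) \<and>
      (\<forall>k. k \<noteq> j \<longrightarrow> (\<forall>w\<in>{1..m}. row ?r k w = row s k w))"
      by (rule run_enlist) (use s0 s in \<open>simp_all add: val_owner\<close>)
    then have r: "b \<notin> {2, 3, 9} \<Longrightarrow> ?r b = s b" "?r 3 = (s 3)(j := x)"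
      "w \<in> {1..m} \<Longrightarrow> row ?r j w = ?q w"
      "k \<noteq> j \<Longrightarrow> w \<in> {1..m} \<Longrightarrow> row ?r k w = row s k w" for b k w
      by blast+
    have sound: "sound x ?r" and marked: "marked x ?r = insert j (marked x s)"
      by (rule sound_extend[where s = s and l = j and q = ?q];
          use s r surplus_start[OF s(5,4) True] vals in \<open>auto\<close>)+
    have r0: "?r 0 = inp" "?r 4 0 = x" "?r 6 0 = j" "?r 1 = s 1" using r(1) s0 s by simp_all
    have x: "ow x \<in> {1..n}" using ow_in s(5) by blast
    have v: "val (numer (owner (cur 4)) (cur 4)) ?r = 0 \<longleftrightarrow> \<beta> = 0"
      using val_numer_eq_0[where s = ?r and e = "owner (cur 4)" and f = "cur 4"]
        val_owner[where s = ?r and f = "cur 4"] r0 s(5) x vals by simp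
    have s': "s' = (if \<beta> = 0 then run emit ?r else ?r)"
      using w True v unfolding s'_def seed_def by simp
    show ?thesis
    proof (cases "\<beta> = 0")
      case False
      then show ?thesis using sound marked True s' r0 by simp
    next
      case zero: True
      note emit = run_emit[where s = ?r and j = j, OF r0(1,3)]
      have "j \<in> marked x ?r" using marked by simp
      then have "surplus x j (row ?r j)" using sound unfolding sound_def by blast
      then have "dominating (row ?r j)" using surplus_dominating zero s(4,5) by blast
      then have "output_ok (run emit ?r 1)"
        by (rule output_okI)
          (use emit sound in \<open>auto simp: sound_def output_ok_def\<close>)
      then have "sound x (run emit ?r)"
        by (intro sound_output[OF sound] emit(1)) auto
      moreover have "marked x (run emit ?r) = marked x ?r" by (intro marked_cong emit(1)) simp
      ultimately show ?thesis using marked True s' zero emit(2) by simp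
    qed
  qed
  then show "sound x s'"
    "marked x s' = (if u (ow x) x < u j x then insert j (marked x s) else marked x s)"
    "s 1 0 \<noteq> 0 \<Longrightarrow> s' 1 0 \<noteq> 0" "u (ow x) x < u j x \<Longrightarrow> \<beta> = 0 \<Longrightarrow> s' 1 0 \<noteq> 0"
    by blast+
qed

lemma run_seeds:
  assumes "sound x s" "s 4 0 = x" "x \<in> {1..m}" "marked x s = {}"
  defines "s' \<equiv> run (Loop 6 0 seed) s"
  shows "sound x s'" "s' 4 0 = x" "marked x s' = {l\<in>{1..n}. u (ow x) x < u l x}"
    "s 1 0 \<noteq> 0 \<Longrightarrow> s' 1 0 \<noteq> 0" "\<beta> = 0 \<Longrightarrow> marked x s' \<noteq> {} \<Longrightarrow> s' 1 0 \<noteq> 0"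
proof -
  let ?I = "\<lambda>k r. sound x r \<and> r 4 0 = x \<and>
    marked x r = {l\<in>{1..n}. k < l \<and> u (ow x) x < u l x} \<and> (s 1 0 \<noteq> 0 \<longrightarrow> r 1 0 \<noteq> 0) \<and>
    (\<beta> = 0 \<longrightarrow> marked x r \<noteq> {} \<longrightarrow> r 1 0 \<noteq> 0)"
  have "?I 0 (loop 6 (run seed) n s)"
  proof (rule loop_rule[where I = ?I])
    show "?I n s" using assms by auto
  next
    fix k r v assume I: "?I k r"
    then show "?I k (upd 6 0 v r)"
      by (simp add: sound_upd marked_upd upd_apply[of 6 _ _ _ 4] upd_apply[of 6 _ _ _ "Suc 0"])
  next
    fix k r assume k: "k < n" and I: "?I (Suc k) r" and c: "r 6 0 = Suc k"
    have j: "Suc k \<in> {1..n}" "Suc k \<notin> marked x r" using k I by auto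
    have R: "sound x r" "r 4 0 = x" using I by auto
    note seed = run_seed[OF R c j(1) assms(3) j(2)]
    have "run seed r 4 = r 4" by (intro run_frame) (simp add: prog_defs)
    then have "run seed r 4 0 = x" using R by simp
    moreover have "marked x (run seed r) = {l\<in>{1..n}. k < l \<and> u (ow x) x < u l x}"
    proof -
      have M: "marked x r = {l\<in>{1..n}. Suc k < l \<and> u (ow x) x < u l x}" using I by blast
      show ?thesis
      proof (cases "u (ow x) x < u (Suc k) x")
        case True
        then show ?thesis unfolding seed(2) M using k Suc_lessI by (intro set_eqI) auto
      next
        case False
        then show ?thesis
          unfolding seed(2) M by (intro set_eqI) (auto, metis Suc_lessI)
      qed
    qed
    moreover have "s 1 0 \<noteq> 0 \<longrightarrow> run seed r 1 0 \<noteq> 0" using I seed(3) by blast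
    moreover have "\<beta> = 0 \<longrightarrow> marked x (run seed r) \<noteq> {} \<longrightarrow> run seed r 1 0 \<noteq> 0"
      using I seed(2,3,4) by presburger
    ultimately show "?I k (run seed r)" using seed(1) by blast
  qed
  then have I: "?I 0 s'" unfolding s'_def using sound_0[OF assms(1)] by (simp add: inp_0)
  then show "sound x s'" "s' 4 0 = x" "s 1 0 \<noteq> 0 \<Longrightarrow> s' 1 0 \<noteq> 0"
    "\<beta> = 0 \<Longrightarrow> marked x s' \<noteq> {} \<Longrightarrow> s' 1 0 \<noteq> 0"
    by blast+
  have "{l\<in>{1..n}. 0 < l \<and> u (ow x) x < u l x} = {l\<in>{1..n}. u (ow x) x < u l x}" by auto
  then show "marked x s' = {l\<in>{1..n}. u (ow x) x < u l x}" using I by metis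
qed

section \<open>Rounds of the search\<close>

text \<open>What every step after seeding respects. That no marks arise from none ties marks to
  seeds, hence to an output if \<open>\<beta> = 0\<close>.\<close>

definition advance :: "nat \<Rightarrow> state \<Rightarrow> state \<Rightarrow> bool" where
  "advance x s s' \<longleftrightarrow> sound x s' \<and> s' 4 0 = x \<and> marked x s \<subseteq> marked x s' \<and>
     (marked x s = {} \<longrightarrow> marked x s' = {}) \<and> (s 1 0 \<noteq> 0 \<longrightarrow> s' 1 0 \<noteq> 0)"

lemma advance_refl: "sound x s \<Longrightarrow> s 4 0 = x \<Longrightarrow> advance x s s"
  unfolding advance_def by simp

lemma advance_trans: "advance x s r \<Longrightarrow> advance x r t \<Longrightarrow> advance x s t"
  unfolding advance_def by blast

lemma advance_upd: "advance x s r \<Longrightarrow> 4 < a \<Longrightarrow> advance x s (upd a i v r)"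
  unfolding advance_def by (simp add: sound_upd marked_upd upd_apply[of _ _ _ _ "Suc 0"] upd_apply[of _ _ _ _ 4])

text \<open>The closure condition of \<open>blocks\<close> for the single object \<open>z\<close>,
  waived once there is an output.\<close>

definition covered :: "nat \<Rightarrow> nat \<Rightarrow> state \<Rightarrow> bool" where
  "covered x z s \<longleftrightarrow>
     s 1 0 \<noteq> 0 \<or> (u (ow z) z = \<alpha> \<and> (\<forall>l\<in>{1..n}. u l z = \<alpha> \<longrightarrow> l \<in> marked x s))"

lemma covered_advance: "covered x z r \<Longrightarrow> advance x r t \<Longrightarrow> covered x z t"
  unfolding covered_def advance_def by blast

lemma covered_upd: "covered x z r \<Longrightarrow> 4 < a \<Longrightarrow> covered x z (upd a i v r)"
  unfolding covered_def marked_def by (simp add: upd_apply)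

lemma run_finish:
  assumes s: "sound x s" "s 4 0 = x" "s 6 0 = j" "s 7 0 = z" "j \<in> marked x s"
    "x \<in> {1..m}" "z \<in> {1..m}" "row s j z = j"
  defines "s' \<equiv> run finish s"
  shows "sound x s'"
    and "a \<notin> {1, 9} \<Longrightarrow> s' a = s a"
    and "s 1 0 \<noteq> 0 \<Longrightarrow> s' 1 0 \<noteq> 0"
    and "s' 1 0 \<noteq> 0 \<or> (u j z = \<alpha> \<and> u (ow x) z \<noteq> \<alpha>)"
proof -
  note s0 = sound_0[OF s(1)]
  have sur: "surplus x j (row s j)" and j: "j \<in> {1..n}"
    using s(1,5) unfolding sound_def marked_def by auto
  then have b: "u (ow x) x = \<beta>" unfolding surplus_def by blast
  have x: "ow x \<in> {1..n}" using ow_in s(6) by blast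
  have "val (owner (cur 4)) s = ow x"
    using val_owner[where s = s and f = "cur 4"] s0 s by simp
  \<comment> \<open>As \<open>u (ow x) x = \<beta>\<close>, exceeding this value means being
    \<open>\<alpha>\<close>.\<close>
  then have w: "val (wants (cur 6) (cur 7)) s = 0 \<longleftrightarrow> u j z \<noteq> \<alpha>"
    "val (wants (owner (cur 4)) (cur 7)) s = 0 \<longleftrightarrow> u (ow x) z \<noteq> \<alpha>"
    using val_wants[where s = s and e = "cur 6" and f = "cur 7" and x = x]
      val_wants[where s = s and e = "owner (cur 4)" and f = "cur 7" and x = x]
      s0 s b j x bivalued[OF j s(7)] bivalued[OF x s(7)] less by auto
  have "sound x s' \<and> (\<forall>a. a \<notin> {1, 9} \<longrightarrow> s' a = s a) \<and> (s 1 0 \<noteq> 0 \<longrightarrow> s' 1 0 \<noteq> 0) \<and>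
    (s' 1 0 \<noteq> 0 \<or> (u j z = \<alpha> \<and> u (ow x) z \<noteq> \<alpha>))"
  proof (cases "u j z = \<alpha> \<and> u (ow x) z \<noteq> \<alpha>")
    case True
    then have "s' = s" using w unfolding s'_def finish_def by simp
    then show ?thesis using True s by simp
  next
    case False
    note emit = run_emit[where s = s and j = j, OF s0 s(3)]
    let ?r = "run emit s"
    have "val (owner (cur 4)) ?r = ow x"
      using val_owner[where s = ?r and f = "cur 4"] emit(1)[of 0] emit(1)[of 4] s0 s by simp
    then have s': "s' = upd 1 (Suc z) (ow x) ?r"
      using False w emit(1)[of 7] s(4) unfolding s'_def finish_def by auto
    have "dominating ((row s j)(z := ow x))"
      using surplus_return_dominating[OF sur s(6) j s(7,8)] False by blast
    then have "output_ok (s' 1)"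
      by (rule output_okI)
        (use emit s(1,7) s' in \<open>auto simp: sound_def output_ok_def upd_apply\<close>)
    moreover have eq: "a \<notin> {1, 9} \<Longrightarrow> s' a = s a" for a
      using emit(1)[of a] s' by (simp add: upd_apply)
    ultimately have "sound x s'" by (intro sound_output[OF s(1)]) auto
    moreover have "s' 1 0 \<noteq> 0" using emit(2) s' by (simp add: upd_apply)
    ultimately show ?thesis using eq by blast
  qed
  then show "sound x s'" "a \<notin> {1, 9} \<Longrightarrow> s' a = s a" "s 1 0 \<noteq> 0 \<Longrightarrow> s' 1 0 \<noteq> 0"
    "s' 1 0 \<noteq> 0 \<or> (u j z = \<alpha> \<and> u (ow x) z \<noteq> \<alpha>)"
    by blast+
qed

lemma run_pass:
  assumes s: "sound x s" "s 4 0 = x" "s 6 0 = j" "s 7 0 = z" "s 8 0 = l" "j \<in> marked x s"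
    "l \<in> {1..n}" "x \<in> {1..m}" "z \<in> {1..m}" "row s j z = j"
  defines "s' \<equiv> run pass s"
  shows "advance x s s'" and "row s' j z = j"
    and "u l z = \<alpha> \<Longrightarrow> l \<noteq> ow x \<Longrightarrow> l \<in> marked x s'"
proof -
  note s0 = sound_0[OF s(1)]
  have sur: "surplus x j (row s j)" and j: "j \<in> {1..n}"
    and keep: "\<And>y. y \<in> {1..m} \<Longrightarrow> ow y \<noteq> ow x \<Longrightarrow> ow y = j \<or> ow y \<notin> marked x s \<Longrightarrow>
      row s j y = ow y"
    using s(1,6) unfolding sound_def marked_def by auto
  then have b: "u (ow x) x = \<beta>" unfolding surplus_def by blast
  have o: "val (owner (cur 4)) s = ow x"
    using val_owner[where s = s and f = "cur 4"] s0 s by simp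
  have w: "val (wants (cur 8) (cur 7)) s = 0 \<longleftrightarrow> u l z \<noteq> \<alpha>"
    using val_wants[where s = s and e = "cur 8" and f = "cur 7" and x = x]
      s0 s b bivalued[OF s(7,9)] less by auto
  have "advance x s s' \<and> row s' j z = j \<and> (u l z = \<alpha> \<longrightarrow> l \<noteq> ow x \<longrightarrow> l \<in> marked x s')"
  proof (cases "l \<notin> marked x s \<and> l \<noteq> ow x \<and> u l z = \<alpha>")
    case False
    then have "s' = s" using w o s(2,5,7) unfolding s'_def pass_def marked_def by auto
    then show ?thesis using False advance_refl[OF s(1,2)] s by auto
  next
    case True
    then have l: "l \<noteq> j" using s(6) by auto
    let ?q = "(row s j)(z := l)"
    have e: "s' = run (enlist (Cell 2 (share (cur 6) (cur 9))) 8 (cur 7)) s"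
      using True w o s(2,5,7) unfolding s'_def pass_def marked_def by auto
    have "(\<forall>b. b \<notin> {2, 3, 9} \<longrightarrow> s' b = s b) \<and> s' 3 = (s 3)(l := x) \<and>
      (\<forall>w\<in>{1..m}. row s' l w = ?q w) \<and>
      (\<forall>k. k \<noteq> l \<longrightarrow> (\<forall>w\<in>{1..m}. row s' k w = row s k w))"
      unfolding e by (rule run_enlist) (use s0 s l in \<open>simp_all add: row_def\<close>)
    then have r: "b \<notin> {2, 3, 9} \<Longrightarrow> s' b = s b" "s' 3 = (s 3)(l := x)"
      "w \<in> {1..m} \<Longrightarrow> row s' l w = ?q w"
      "k \<noteq> l \<Longrightarrow> w \<in> {1..m} \<Longrightarrow> row s' k w = row s k w" for b k w
      by blast+
    have "surplus x l ?q"
      using surplus_pass[OF sur j s(9,10,7)] True l by blast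
    moreover have "?q y = ow y"
      if "y \<in> {1..m}" "ow y \<noteq> ow x" "ow y = l \<or> ow y \<notin> marked x s" for y
    proof -
      \<comment> \<open>In the row of \<open>j\<close> the unmarked owner still has
        \<open>y\<close>, while \<open>z\<close> is with the marked agent \<open>j\<close>, so
        \<open>y\<close> is not \<open>z\<close>.\<close>
      have "ow y \<noteq> j" using that(3) s(6) l by auto
      moreover have "row s j y = ow y" using keep that True by auto
      ultimately show ?thesis using s(10) by auto
    qed
    ultimately have "sound x s'" "marked x s' = insert l (marked x s)"
      using sound_extend[where s = s and s' = s' and q = ?q, OF s(1,8,7)] True r by auto
    then show ?thesis using r(1)[of 1] r(1)[of 4] r(4)[of j z] s l unfolding advance_def by auto
  qed
  then show "advance x s s'" "row s' j z = j"
    "u l z = \<alpha> \<Longrightarrow> l \<noteq> ow x \<Longrightarrow> l \<in> marked x s'"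
    by blast+
qed

lemma run_visit:
  assumes s: "sound x s" "s 4 0 = x" "s 6 0 = j" "s 7 0 = z" "j \<in> {1..n}" "x \<in> {1..m}"
    "z \<in> {1..m}"
  defines "s' \<equiv> run visit s"
  shows "advance x s s'" and "j \<in> marked x s \<Longrightarrow> ow z = j \<Longrightarrow> covered x z s'"
proof -
  note s0 = sound_0[OF s(1)]
  have "advance x s s' \<and> (j \<in> marked x s \<longrightarrow> ow z = j \<longrightarrow> covered x z s')"
  proof (cases "j \<in> marked x s \<and> row s j z = j")
    case False
    then have "s' = s"
      using s0 s unfolding s'_def visit_def marked_def row_def by auto
    \<comment> \<open>By the last clause of \<open>sound\<close>, an object skipped for a marked
      agent is not one he owns.\<close>
    moreover have "row s j z = j" if "j \<in> marked x s" "ow z = j"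
    proof -
      have "j \<noteq> ow x" using s(1) that unfolding sound_def surplus_def by blast
      then show ?thesis using s(1,7) that unfolding sound_def by blast
    qed
    ultimately show ?thesis using False advance_refl[OF s(1,2)] by auto
  next
    case True
    let ?f = "run finish s"
    note finish = run_finish[OF s(1-4) _ s(6,7)]
    have s': "s' = run (Loop 8 0 pass) ?f"
      using True s0 s unfolding s'_def visit_def marked_def row_def by auto
    have f: "sound x ?f" "s 1 0 \<noteq> 0 \<Longrightarrow> ?f 1 0 \<noteq> 0"
      "?f 1 0 \<noteq> 0 \<or> (u j z = \<alpha> \<and> u (ow x) z \<noteq> \<alpha>)"
      and eq: "\<And>a. a \<notin> {1, 9} \<Longrightarrow> ?f a = s a"
      using finish s(3) True by auto
    let ?I = "\<lambda>k r. advance x ?f r \<and> r 6 0 = j \<and> r 7 0 = z \<and> row r j z = j \<and>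
      (\<forall>l\<in>{1..n}. k < l \<longrightarrow> u l z = \<alpha> \<longrightarrow> l \<noteq> ow x \<longrightarrow> l \<in> marked x r)"
    have "?I 0 (loop 8 (run pass) n ?f)"
    proof (rule loop_rule[where I = ?I])
      show "?I n ?f"
        using advance_refl[of x ?f] f(1) eq s True unfolding row_def by auto
    next
      fix k r v assume I: "?I k r"
      then have "advance x ?f (upd 8 0 v r)" using advance_upd by simp
      then show "?I k (upd 8 0 v r)" using I unfolding row_def marked_def by (simp add: upd_apply)
    next
      fix k r assume k: "k < n" and I: "?I (Suc k) r" and c: "r 8 0 = Suc k"
      have r: "sound x r" "r 4 0 = x" "r 6 0 = j" "r 7 0 = z" "row r j z = j" "j \<in> marked x r"
        using I True eq[of 3] unfolding advance_def marked_def by auto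
      have l: "Suc k \<in> {1..n}" using k by simp
      note pass = run_pass[OF r(1-4) c r(6) l s(6,7) r(5)]
      have "run pass r 6 = r 6" "run pass r 7 = r 7"
        by (intro run_frame; simp add: prog_defs)+
      moreover have "\<forall>l\<in>{1..n}. k < l \<longrightarrow> u l z = \<alpha> \<longrightarrow> l \<noteq> ow x \<longrightarrow> l \<in> marked x (run pass r)"
      proof (intro ballI impI)
        fix l assume l: "l \<in> {1..n}" "k < l" "u l z = \<alpha>" "l \<noteq> ow x"
        show "l \<in> marked x (run pass r)"
        proof (cases "l = Suc k")
          case True
          then show ?thesis using pass(3) l by blast
        next
          case False
          then have "l \<in> marked x r" using I l by auto
          then show ?thesis using pass(1) unfolding advance_def by blast
        qed
      qed
      ultimately show "?I k (run pass r)" using I pass advance_trans r by auto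
    qed
    then have I: "?I 0 s'" unfolding s' using eq[of 0] s0 by (simp add: inp_0)
    have "advance x s ?f"
      using f(1) f(2) eq s marked_cong[of ?f s x] unfolding advance_def by auto
    then have "advance x s s'" using I advance_trans by blast
    \<comment> \<open>\<open>pass\<close> leaves out \<open>ow x\<close>; for him
      \<open>finish\<close> has excluded the value \<open>\<alpha>\<close> unless it wrote an
      output.\<close>
    moreover have "covered x z s'" if "ow z = j"
      using I f(3) that unfolding covered_def advance_def by auto
    ultimately show ?thesis by blast
  qed
  then show "advance x s s'" "j \<in> marked x s \<Longrightarrow> ow z = j \<Longrightarrow> covered x z s'" by blast+
qed

lemma run_agent:
  assumes s: "sound x s" "s 4 0 = x" "s 6 0 = j" "j \<in> {1..n}" "x \<in> {1..m}"
  defines "s' \<equiv> run (Loop 7 1 visit) s"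
  shows "advance x s s'"
    and "j \<in> marked x s \<Longrightarrow> z \<in> {1..m} \<Longrightarrow> ow z = j \<Longrightarrow> covered x z s'"
proof -
  let ?I = "\<lambda>k r. advance x s r \<and> r 6 0 = j \<and>
    (\<forall>z\<in>{1..m}. k < z \<longrightarrow> j \<in> marked x s \<longrightarrow> ow z = j \<longrightarrow> covered x z r)"
  have "?I 0 (loop 7 (run visit) m s)"
  proof (rule loop_rule[where I = ?I])
    show "?I m s" using advance_refl s by auto
  next
    fix k r v assume "?I k r"
    then show "?I k (upd 7 0 v r)"
      using advance_upd covered_upd by (simp add: upd_apply)
  next
    fix k r assume k: "k < m" and I: "?I (Suc k) r" and c: "r 7 0 = Suc k"
    have r: "sound x r" "r 4 0 = x" "r 6 0 = j" "marked x s \<subseteq> marked x r"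
      using I unfolding advance_def by auto
    have z: "Suc k \<in> {1..m}" using k by simp
    note visit = run_visit[OF r(1-3) c s(4,5) z]
    have "run visit r 6 = r 6" by (intro run_frame) (simp add: prog_defs)
    moreover have "\<forall>z\<in>{1..m}. k < z \<longrightarrow> j \<in> marked x s \<longrightarrow> ow z = j \<longrightarrow> covered x z (run visit r)"
    proof (intro ballI impI)
      fix z assume z: "z \<in> {1..m}" "k < z" "j \<in> marked x s" "ow z = j"
      show "covered x z (run visit r)"
      proof (cases "z = Suc k")
        case True
        then show ?thesis using visit(2) z r(4) by blast
      next
        case False
        then have "covered x z r" using I z by auto
        then show ?thesis using visit(1) covered_advance by blast
      qed
    qed
    ultimately show "?I k (run visit r)" using I visit(1) advance_trans r by auto
  qed
  then have "?I 0 s'" unfolding s'_def using sound_0[OF s(1)] by (simp add: inp_1)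
  then show "advance x s s'"
    "j \<in> marked x s \<Longrightarrow> z \<in> {1..m} \<Longrightarrow> ow z = j \<Longrightarrow> covered x z s'"
    by auto
qed

text \<open>The claim concerns agents marked before the round, since one marked after his turn is
  dealt with only in the next round.\<close>

lemma run_round:
  assumes s: "sound x s" "s 4 0 = x" "x \<in> {1..m}"
  defines "s' \<equiv> run (Loop 6 0 (Loop 7 1 visit)) s"
  shows "advance x s s'"
    and "z \<in> {1..m} \<Longrightarrow> ow z \<in> marked x s \<Longrightarrow> covered x z s'"
proof -
  let ?b = "Loop 7 1 visit"
  let ?I = "\<lambda>k r. advance x s r \<and>
    (\<forall>z\<in>{1..m}. k < ow z \<longrightarrow> ow z \<in> marked x s \<longrightarrow> covered x z r)"
  have "?I 0 (loop 6 (run ?b) n s)"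
  proof (rule loop_rule[where I = ?I])
    show "?I n s" using advance_refl s ow_in by fastforce
  next
    fix k r v assume "?I k r"
    then show "?I k (upd 6 0 v r)"
      using advance_upd covered_upd by simp
  next
    fix k r assume k: "k < n" and I: "?I (Suc k) r" and c: "r 6 0 = Suc k"
    have r: "sound x r" "r 4 0 = x" "marked x s \<subseteq> marked x r"
      using I unfolding advance_def by auto
    have j: "Suc k \<in> {1..n}" using k by simp
    note agent = run_agent[OF r(1,2) c j s(3)]
    have "\<forall>z\<in>{1..m}. k < ow z \<longrightarrow> ow z \<in> marked x s \<longrightarrow> covered x z (run ?b r)"
    proof (intro ballI impI)
      fix z assume z: "z \<in> {1..m}" "k < ow z" "ow z \<in> marked x s"
      show "covered x z (run ?b r)"
      proof (cases "ow z = Suc k")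
        case True
        then show ?thesis using agent(2)[of z] z r(3) by auto
      next
        case False
        then have "covered x z r" using I z by auto
        then show ?thesis using agent(1) covered_advance by blast
      qed
    qed
    then show "?I k (run ?b r)" using I agent(1) advance_trans by blast
  qed
  then have "?I 0 s'" unfolding s'_def using sound_0[OF s(1)] by (simp add: inp_0)
  then show "advance x s s'" "z \<in> {1..m} \<Longrightarrow> ow z \<in> marked x s \<Longrightarrow> covered x z s'"
    using ow_in by fastforce+
qed

text \<open>A round without output and without new marks turns the marked set into a certificate.
  Otherwise the marks grow, which cannot go on for \<open>n\<close> rounds because
  \<open>ow x\<close> is never marked.\<close>

lemma run_search:
  assumes s: "sound x s" "s 4 0 = x" "x \<in> {1..m}" "marked x s = {}"
  defines "s' \<equiv> run search s"
  shows "sound x s'" and "s 1 0 \<noteq> 0 \<Longrightarrow> s' 1 0 \<noteq> 0" and "s' 1 0 \<noteq> 0 \<or> (\<exists>R. blocks R x)"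
proof -
  let ?s = "run (Loop 6 0 seed) s" and ?b = "Loop 6 0 (Loop 7 1 visit)"
  note seeds = run_seeds[OF s]
  have s': "s' = run (Loop 5 0 ?b) ?s" unfolding s'_def search_def by simp
  let ?I = "\<lambda>k r. advance x ?s r \<and>
    (r 1 0 \<noteq> 0 \<or> n \<le> card (marked x r) + k \<or> (\<exists>R. blocks R x))"
  have fin: "finite (marked x r)" for r unfolding marked_def by simp
  have "?I 0 (loop 5 (run ?b) n ?s)"
  proof (rule loop_rule[where I = ?I])
    show "?I n ?s" using advance_refl seeds by simp
  next
    fix k r v assume "?I k r"
    then show "?I k (upd 5 0 v r)"
      using advance_upd[of x ?s r 5] unfolding marked_def by (simp add: upd_apply)
  next
    fix k r assume I: "?I (Suc k) r"
    then have r: "sound x r" "r 4 0 = x" "advance x ?s r" unfolding advance_def by auto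
    let ?t = "run ?b r"
    note round = run_round[OF r(1,2) s(3)]
    have t: "advance x ?s ?t" using round(1) r(3) advance_trans by blast
    have "?t 1 0 \<noteq> 0 \<or> n \<le> card (marked x ?t) + k \<or> (\<exists>R. blocks R x)"
    proof (cases "marked x ?t = marked x r \<and> ?t 1 0 = 0")
      case True
      \<comment> \<open>Marks go back to seeds, which would have produced an output for
        \<open>\<beta> = 0\<close>.\<close>
      have "\<beta> \<noteq> 0" if "marked x ?t \<noteq> {}"
        using that t seeds(5) True unfolding advance_def by auto
      then have "blocks (marked x ?t) x"
        using round(2) t seeds(3) True unfolding blocks_def covered_def advance_def marked_def
        by blast
      then show ?thesis by blast
    next
      case False
      moreover have "card (marked x r) < card (marked x ?t)" if "marked x ?t \<noteq> marked x r"
        using that round(1) fin unfolding advance_def by (intro psubset_card_mono) auto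
      ultimately show ?thesis using I round(1) unfolding advance_def by fastforce
    qed
    then show "?I k ?t" using t by blast
  qed
  then have I: "?I 0 s'" unfolding s' using sound_0[OF seeds(1)] by (simp add: inp_0)
  then show sound: "sound x s'" and "s 1 0 \<noteq> 0 \<Longrightarrow> s' 1 0 \<noteq> 0"
    using seeds(4) unfolding advance_def by auto
  have "marked x s' \<subseteq> {1..n} - {ow x}"
    using sound unfolding sound_def surplus_def marked_def by blast
  then have "card (marked x s') \<le> card ({1..n} - {ow x})" by (intro card_mono) auto
  also have "\<dots> < n" using ow_in[OF s(3)] by (subst card_Diff_singleton) auto
  finally show "s' 1 0 \<noteq> 0 \<or> (\<exists>R. blocks R x)" using I by auto
qed

section \<open>Correctness of the whole program\<close>

lemma run_improve:
  assumes "s 0 = inp" "\<And>a i. a \<noteq> 0 \<Longrightarrow> s a i = 0"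
  defines "s' \<equiv> run improve s"
  shows "(s' 1 0 = 1 \<and> s' 1 1 = 1 \<and> (\<forall>q. \<not> dominating q)) \<or>
    (s' 1 0 = Suc m \<and> s' 1 1 = 0 \<and> dominating (\<lambda>z. s' 1 (Suc z)))"
proof -
  let ?I = "\<lambda>k (r :: state). r 0 = inp \<and> output_ok (r 1) \<and> (\<forall>l. r 3 l = 0 \<or> k < r 3 l) \<and>
    (r 1 0 \<noteq> 0 \<or> (\<forall>x\<in>{1..m}. k < x \<longrightarrow> (\<exists>R. blocks R x)))"
  let ?s = "run (Loop 4 1 search) s"
  have "?I 0 (loop 4 (run search) m s)"
  proof (rule loop_rule[where I = ?I])
    show "?I m s" using assms unfolding output_ok_def by auto
  next
    fix k r v assume "?I k r"
    then show "?I k (upd 4 0 v r)" by (simp add: upd_apply)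
  next
    fix k r assume k: "k < m" and I: "?I (Suc k) r" and c: "r 4 0 = Suc k"
    have stamps: "\<forall>l. r 3 l = 0 \<or> Suc k < r 3 l" using I by blast
    \<comment> \<open>All marks so far exceed the current object, so its search starts with no agent
      marked.\<close>
    have "r 3 l \<noteq> Suc k" for l using stamps[rule_format, of l] by auto
    then have m: "marked (Suc k) r = {}" unfolding marked_def by simp
    then have "sound (Suc k) r" using I unfolding sound_def by (auto intro: less_imp_le)
    note search = run_search[OF this c _ m]
    have x: "Suc k \<in> {1..m}" using k by simp
    have "\<forall>x\<in>{1..m}. k < x \<longrightarrow> (\<exists>R. blocks R x)" if "run search r 1 0 = 0"
    proof (intro ballI impI)
      fix x assume y: "x \<in> {1..m}" "k < x"
      show "\<exists>R. blocks R x"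
      proof (cases "x = Suc k")
        case True
        then show ?thesis using search(3)[OF x] that by blast
      next
        case False
        then have "Suc k < x" using y by simp
        then show ?thesis using I search(2)[OF x] that y by auto
      qed
    qed
    then show "?I k (run search r)"
      using search(1)[OF x] unfolding sound_def by (auto simp: Suc_le_eq)
  qed
  then have I: "?I 0 ?s" using assms(1) by (simp add: inp_1)
  show ?thesis
  proof (cases "?s 1 0 = 0")
    case True
    have "s' = upd 1 1 1 (upd 1 0 1 ?s)"
      using True unfolding s'_def improve_def by simp
    moreover have "\<forall>x\<in>{1..m}. \<exists>R. blocks R x" using I True by auto
    ultimately show ?thesis using not_dominating_if_blocked by (auto simp: upd_apply)
  next
    case False
    then have "s' = ?s" unfolding s'_def improve_def by simp
    then show ?thesis using I False unfolding output_ok_def by auto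
  qed
qed

end

section \<open>Encodings\<close>

lemma length_concat_upt:
  "(\<And>i. i < k \<Longrightarrow> length (f i) = c) \<Longrightarrow> length (concat (map f [0..<k])) = k * c"
  by (induction k) auto

lemma nth_concat_upt:
  assumes "\<And>i. i < k \<Longrightarrow> length (f i) = c" "i < k" "r < c"
  shows "concat (map f [0..<k]) ! (i * c + r) = f i ! r"
  using assms
proof (induction k)
  case (Suc k)
  have len: "length (concat (map f [0..<k])) = k * c"
    using Suc.prems(1) by (intro length_concat_upt) simp
  show ?case
  proof (cases "i = k")
    case True
    then show ?thesis using len by (simp add: nth_append)
  next
    case False
    then have "Suc i \<le> k" using Suc.prems(2) by simp
    then have "i * c + r < k * c"
      using Suc.prems(3) mult_le_mono1[of "Suc i" k c] by simp
    then show ?thesis using Suc False len by (simp add: nth_append)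
  qed
qed simp

lemma map_upt_Suc: "map f [1..<Suc k] = map (\<lambda>i. f (Suc i)) [0..<k]"
  unfolding One_nat_def map_Suc_upt[symmetric] by simp

context
  fixes n m :: nat and u :: "nat \<Rightarrow> nat \<Rightarrow> rat"
begin

lemma length_encode_utilities_row:
  "length (concat (map (\<lambda>j. encode_rat (u i j)) [1..<Suc m])) = m * 2"
  unfolding map_upt_Suc by (intro length_concat_upt) (simp add: encode_rat_def)

lemma length_encode_utilities: "length (encode_utilities n m u) = n * (m * 2)"
  unfolding encode_utilities_def map_upt_Suc[of _ n]
  by (intro length_concat_upt length_encode_utilities_row)

lemma length_encode_instance: "length (encode_instance n m u p) = 2 + n * (m * 2) + m"
  unfolding encode_instance_def encode_assignment_def by (simp add: length_encode_utilities)

lemma nth_encode_utilities: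
  assumes "i \<in> {1..n}" "z \<in> {1..m}" "r < 2"
  shows "encode_utilities n m u ! ((i - 1) * (m * 2) + ((z - 1) * 2 + r)) = encode_rat (u i z) ! r"
proof -
  have z: "(z - 1) * 2 + r < m * 2" "z - 1 < m" and i: "i - 1 < n" using assms by auto
  have "encode_utilities n m u ! ((i - 1) * (m * 2) + ((z - 1) * 2 + r)) =
      concat (map (\<lambda>j. encode_rat (u i j)) [1..<Suc m]) ! ((z - 1) * 2 + r)"
    unfolding encode_utilities_def map_upt_Suc[of _ n]
    using nth_concat_upt[of n "\<lambda>i. concat (map (\<lambda>j. encode_rat (u (Suc i) j)) [1..<Suc m])"
        "m * 2" "i - 1", OF length_encode_utilities_row i z(1)] assms(1) by (simp del: upt_Suc)
  also have "\<dots> = encode_rat (u i z) ! r"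
    unfolding map_upt_Suc
    using nth_concat_upt[of m "\<lambda>j. encode_rat (u i (Suc j))" 2 "z - 1" r] z(2) assms
    by (simp add: encode_rat_def)
  finally show ?thesis .
qed

lemma nth_encode_instance:
  "encode_instance n m u p ! 0 = n" "encode_instance n m u p ! 1 = m"
  "i \<in> {1..n} \<Longrightarrow> z \<in> {1..m} \<Longrightarrow>
    encode_instance n m u p ! (2 * ((i - 1) * m + z)) = nat (fst (quotient_of (u i z)))"
  "i \<in> {1..n} \<Longrightarrow> z \<in> {1..m} \<Longrightarrow>
    encode_instance n m u p ! Suc (2 * ((i - 1) * m + z)) = nat (snd (quotient_of (u i z)))"
  "z \<in> {1..m} \<Longrightarrow>
    encode_instance n m u p ! (2 * (n * m) + Suc z) = (THE i. i \<in> {1..n} \<and> z \<in> p i)"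
proof -
  show "encode_instance n m u p ! 0 = n" "encode_instance n m u p ! 1 = m"
    unfolding encode_instance_def by simp_all
  have utility: "encode_instance n m u p ! (2 * ((i - 1) * m + z) + r) = encode_rat (u i z) ! r"
    if "i \<in> {1..n}" "z \<in> {1..m}" "r < 2" for i z r
  proof -
    let ?k = "(i - 1) * (m * 2) + ((z - 1) * 2 + r)"
    have "(i - 1) * (m * 2) + m * 2 \<le> n * (m * 2)"
      using mult_le_mono1[of "Suc (i - 1)" n "m * 2"] that(1) by simp
    moreover have "(z - 1) * 2 + r < m * 2" using that(2,3) by auto
    ultimately have k: "?k < length (encode_utilities n m u)"
      unfolding length_encode_utilities by linarith
    have "2 * z = Suc (Suc ((z - 1) * 2))" using that(2) by auto
    then have "2 * ((i - 1) * m + z) + r = Suc (Suc ?k)" by (simp add: algebra_simps)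
    then show ?thesis
      using nth_encode_utilities[OF that] k unfolding encode_instance_def
      by (simp only: append_Cons nth_Cons_Suc append_Nil nth_append if_True)
  qed
  show "encode_instance n m u p ! (2 * ((i - 1) * m + z)) = nat (fst (quotient_of (u i z)))"
    "encode_instance n m u p ! Suc (2 * ((i - 1) * m + z)) = nat (snd (quotient_of (u i z)))"
    if "i \<in> {1..n}" "z \<in> {1..m}"
    using utility[OF that, of 0] utility[OF that, of 1] by (simp_all add: encode_rat_def)
  show "encode_instance n m u p ! (2 * (n * m) + Suc z) = (THE i. i \<in> {1..n} \<and> z \<in> p i)"
    if "z \<in> {1..m}"
  proof -
    from that obtain k where k: "z = Suc k" "k < m" by (cases z) auto
    then have "2 * (n * m) + Suc z = Suc (Suc (length (encode_utilities n m u) + k))"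
      unfolding length_encode_utilities by simp
    moreover have "[1..<Suc m] ! k = z" using k by (subst nth_upt) auto
    ultimately show ?thesis
      using k(2) unfolding encode_instance_def encode_assignment_def
      by (simp add: nth_append_length_plus del: upt_Suc)
  qed
qed

end

section \<open>Assignments and owner functions\<close>

definition owner_of :: "nat \<Rightarrow> (nat \<Rightarrow> nat set) \<Rightarrow> nat \<Rightarrow> nat" where
  "owner_of n q z = (THE i. i \<in> {1..n} \<and> z \<in> q i)"

lemma owner_of_eq:
  assumes "assignment {1..n} {1..m} q" "i \<in> {1..n}" "z \<in> q i"
  shows "owner_of n q z = i"
  unfolding owner_of_def
proof (rule the_equality)
  fix k assume "k \<in> {1..n} \<and> z \<in> q k"
  then show "k = i"
    using assms disjoint_family_onD[of q "{1..n}" k i] unfolding assignment_def by blast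
qed (use assms in blast)

lemma owner_of_in:
  assumes "assignment {1..n} {1..m} q" "z \<in> {1..m}"
  shows "owner_of n q z \<in> {1..n}" "z \<in> q (owner_of n q z)"
proof -
  obtain i where "i \<in> {1..n}" "z \<in> q i" using assms unfolding assignment_def by blast
  then show "owner_of n q z \<in> {1..n}" "z \<in> q (owner_of n q z)"
    using owner_of_eq[OF assms(1)] by auto
qed

lemma bundle_eq_owner_of:
  assumes "assignment {1..n} {1..m} q" "i \<in> {1..n}"
  shows "q i = {z \<in> {1..m}. owner_of n q z = i}"
  using assms owner_of_eq[OF assms(1)] owner_of_in[OF assms(1)]
  by (auto simp: assignment_def)

text \<open>The way back from an owner function, by which the output is read as an
  assignment.\<close>

definition bundles :: "nat \<Rightarrow> (nat \<Rightarrow> nat) \<Rightarrow> nat \<Rightarrow> nat set" where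
  "bundles m f i = {z \<in> {1..m}. f z = i}"

lemma assignment_bundles:
  assumes "\<And>z. z \<in> {1..m} \<Longrightarrow> f z \<in> {1..n}"
  shows "assignment {1..n} {1..m} (bundles m f)"
  using assms unfolding assignment_def bundles_def disjoint_family_on_def by fastforce

lemma owner_of_bundles:
  assumes "\<And>z. z \<in> {1..m} \<Longrightarrow> f z \<in> {1..n}" "z \<in> {1..m}"
  shows "owner_of n (bundles m f) z = f z"
  by (rule owner_of_eq[OF assignment_bundles[OF assms(1)] assms(1)])
    (use assms(2) in \<open>auto simp: bundles_def\<close>)

lemma encode_assignment_eq: "encode_assignment n m q = map (owner_of n q) [1..<Suc m]"
  unfolding encode_assignment_def owner_of_def ..

context allocation
begin

lemma utility_eq_worth:
  assumes "assignment {1..n} {1..m} q" "i \<in> {1..n}"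
  shows "utility u i (q i) = worth i (owner_of n q)"
  unfolding utility_def worth_def bundle_eq_owner_of[OF assms]
  by (rule sum.inter_filter) simp

lemma pareto_dominates_iff:
  assumes "assignment {1..n} {1..m} q" "assignment {1..n} {1..m} p" "ow = owner_of n p"
  shows "pareto_dominates {1..n} u q p \<longleftrightarrow> dominating (owner_of n q)"
  unfolding pareto_dominates_def dominating_def
  using utility_eq_worth[OF assms(1)] utility_eq_worth[OF assms(2)] assms(3)
    owner_of_in(1)[OF assms(1)] by simp

end

section \<open>The algorithm and its polynomial time bound\<close>

theorem theorem6:
  "\<exists>(c :: com) (P :: nat poly).
     \<forall>(n :: nat) (m :: nat) (u :: nat \<Rightarrow> nat \<Rightarrow> rat) (p :: nat \<Rightarrow> nat set).
       (\<forall>i\<in>{1..n}. \<forall>j\<in>{1..m}. u i j \<ge> 0) \<and>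
       bivalued {1..n} {1..m} u \<and>
       assignment {1..n} {1..m} p \<longrightarrow>
       (\<exists>ans t.
          runs c (encode_instance n m u p) (encode_answer n m ans) t \<and>
          t \<le> poly P (bit_size (encode_instance n m u p)) \<and>
          (ans = None \<longleftrightarrow> pareto_optimal {1..n} {1..m} u p) \<and>
          (\<forall>q. ans = Some q \<longrightarrow>
             assignment {1..n} {1..m} q \<and> pareto_dominates {1..n} u q p))"
proof (intro exI[of _ "compile improve"] exI[of _ "time improve * [:3, 1:] + [:2, 1:] * [:3, 1:]"]
    allI impI, elim conjE)
  fix n m :: nat and u p
  assume biv: "bivalued {1..n} {1..m} u" and p: "assignment {1..n} {1..m} p"
  let ?xs = "encode_instance n m u p" and ?ow = "owner_of n p"
  \<comment> \<open>The second summand of \<open>?P\<close> pays for the output: at most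
    \<open>?B + 2\<close> entries of at most \<open>?B + 3\<close> units each.\<close>
  let ?B = "bit_size ?xs" and ?P = "time improve * [:3, 1:] + [:2, 1:] * [:3, 1:] :: nat poly"
  let ?s = "run improve (init ?xs)"
  have len: "length ?xs = 2 + n * (m * 2) + m" by (rule length_encode_instance)
  obtain \<alpha> \<beta> where ab: "\<beta> < \<alpha>" "0 \<le> \<beta>" "\<forall>i\<in>{1..n}. \<forall>x\<in>{1..m}. u i x \<in> {\<alpha>, \<beta>}"
    using biv unfolding bivalued_def by blast
  have inp: "init ?xs 0 k = ?xs ! k" if "k < length ?xs" for k using that by (simp add: init_def)
  have position: "2 * ((i - 1) * m + z) < length ?xs" "Suc (2 * ((i - 1) * m + z)) < length ?xs"
    if "i \<in> {1..n}" "z \<in> {1..m}" for i z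
  proof -
    have "(i - 1) * m + m \<le> n * m"
      using mult_le_mono1[of "Suc (i - 1)" n m] that(1) by simp
    then have "2 * ((i - 1) * m + z) \<le> 2 * (n * m)" using that(2) by simp
    then show "2 * ((i - 1) * m + z) < length ?xs" "Suc (2 * ((i - 1) * m + z)) < length ?xs"
      using that(2) unfolding len by simp_all
  qed
  interpret allocation_input n m u ?ow \<alpha> \<beta> "init ?xs 0"
  proof
    show "\<beta> < \<alpha>" "0 \<le> \<beta>" by (fact ab)+
    show "u i z = \<alpha> \<or> u i z = \<beta>" if "i \<in> {1..n}" "z \<in> {1..m}" for i z using ab(3) that by blast
    show "?ow z \<in> {1..n}" if "z \<in> {1..m}" for z using owner_of_in(1)[OF p that] .
    show "init ?xs 0 0 = n" "init ?xs 0 (Suc 0) = m"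
      using inp[of 0] inp[of 1] nth_encode_instance(1,2) by (simp_all add: len)
    show "init ?xs 0 (2 * ((i - 1) * m + z)) = nat (fst (quotient_of (u i z)))"
      "init ?xs 0 (Suc (2 * ((i - 1) * m + z))) = nat (snd (quotient_of (u i z)))"
      if "i \<in> {1..n}" "z \<in> {1..m}" for i z
      using inp position[OF that] nth_encode_instance(3,4)[OF that] by simp_all
    show "init ?xs 0 (2 * (n * m) + Suc z) = ?ow z" if "z \<in> {1..m}" for z
      using inp[of "2 * (n * m) + Suc z"] nth_encode_instance(5)[OF that] that
      unfolding owner_of_def by (simp add: len)
  qed
  have m_le: "m \<le> ?B" using length_le_bit_size[of ?xs] unfolding len by simp
  \<comment> \<open>If there are objects, the table of utilities has at least \<open>n\<close>
    entries.\<close>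
  have n_le: "n \<le> ?B" if "m \<noteq> 0"
  proof -
    have "n * 1 \<le> n * (m * 2)" using that by (intro mult_le_mono) auto
    then show ?thesis using length_le_bit_size[of ?xs] unfolding len mult_1_right by linarith
  qed
  note exec = exec_compile_init[OF legal_improve, of ?xs]
  obtain t where t: "exec (compile improve) (init ?xs) t ?s"
    "t \<le> poly (time improve * [:3, 1:]) ?B"
    using exec(1) m_le n_le inp_0 inp_1 by auto
  have small: "?s a i \<le> 2 ^ Suc ?B" for a i
    using exec(2) m_le n_le inp_0 inp_1 by auto
  have bits: "bits (?s a i) \<le> ?B + 3" for a i
    using order.strict_trans1[OF small, of "2 ^ Suc (Suc ?B)" a i]
      floorlog_2_le[of "?s a i" "Suc (Suc ?B)"] unfolding bits_def by simp
  have size: "bit_size (map (?s 1) [1..<Suc k]) \<le> k * (?B + 3)" for k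
    using bit_size_map_le[of "[1..<Suc k]" "?s 1" "?B + 3"] bits by (simp del: upt_Suc)
  have run: "runs (compile improve) ?xs (result_of ?s) (t + bit_size (result_of ?s))"
    using t(1) unfolding runs_def by blast
  consider "?s 1 0 = 1" "?s 1 1 = 1" "\<forall>q. \<not> dominating q"
    | "?s 1 0 = Suc m" "?s 1 1 = 0" "dominating (\<lambda>z. ?s 1 (Suc z))"
    using run_improve[of "init ?xs"] by (auto simp: init_def)
  then show "\<exists>ans t. runs (compile improve) ?xs (encode_answer n m ans) t \<and> t \<le> poly ?P ?B \<and>
      (ans = None \<longleftrightarrow> pareto_optimal {1..n} {1..m} u p) \<and>
      (\<forall>q. ans = Some q \<longrightarrow> assignment {1..n} {1..m} q \<and> pareto_dominates {1..n} u q p)"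
  proof cases
    case 1
    have "bit_size (result_of ?s) \<le> 1 * (?B + 3)"
      using size[of 1] 1(1) unfolding result_of_def by simp
    then have "t + bit_size (result_of ?s) \<le> poly ?P ?B" using t(2) by (simp add: algebra_simps)
    moreover have "result_of ?s = encode_answer n m None"
      using 1 unfolding result_of_def encode_answer_def by simp
    moreover have "pareto_optimal {1..n} {1..m} u p"
      using 1(3) pareto_dominates_iff[OF _ p refl] unfolding pareto_optimal_def by blast
    ultimately show ?thesis using run by (intro exI[of _ None]) auto
  next
    case 2
    define q where "q = bundles m (\<lambda>z. ?s 1 (Suc z))"
    have in_n: "\<And>z. z \<in> {1..m} \<Longrightarrow> ?s 1 (Suc z) \<in> {1..n}"
      using 2(3) unfolding dominating_def by blast
    have q: "assignment {1..n} {1..m} q" unfolding q_def by (rule assignment_bundles[OF in_n])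
    have owner: "owner_of n q z = ?s 1 (Suc z)" if "z \<in> {1..m}" for z
      unfolding q_def by (rule owner_of_bundles[OF in_n that])
    have "dominating (owner_of n q)"
      by (rule dominating_cong[OF 2(3)]) (simp add: owner)
    then have dom: "pareto_dominates {1..n} u q p" using pareto_dominates_iff[OF q p refl] by blast
    have "bit_size (result_of ?s) \<le> Suc m * (?B + 3)"
      using size[of "Suc m"] 2(1) unfolding result_of_def by simp
    also have "\<dots> \<le> (?B + 2) * (?B + 3)" using m_le by (intro mult_le_mono) auto
    finally have "t + bit_size (result_of ?s) \<le> poly ?P ?B"
      using t(2) by (simp add: algebra_simps)
    moreover have "result_of ?s = encode_answer n m (Some q)"
    proof -
      have "result_of ?s = ?s 1 1 # map (\<lambda>z. ?s 1 (Suc z)) [1..<Suc m]"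
        unfolding result_of_def 2(1) map_upt_Suc by (simp add: upt_conv_Cons map_Suc_upt[symmetric] del: upt_Suc)
      also have "map (\<lambda>z. ?s 1 (Suc z)) [1..<Suc m] = encode_assignment n m q"
        unfolding encode_assignment_eq using owner by (intro map_cong) auto
      finally show ?thesis using 2(2) unfolding encode_answer_def by simp
    qed
    moreover have "\<not> pareto_optimal {1..n} {1..m} u p"
      using q dom unfolding pareto_optimal_def by blast
    ultimately show ?thesis using run q dom by (intro exI[of _ "Some q"]) auto
  qed
qed

end
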